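(* Assume (A) every multiple zeta value $\zeta(k_1,\dots,k_n)$ (admissible index, weight $k=k_1+\dots+k_n$, depth $n$) lies in $\mathrm{span}_{\mathbb{Q}}S'_{k,n}$; and (B) for every index $\mathbf{k}=(k_1,\dots,k_n)\in\mathbb{N}^n$ of weight $k=|\mathbf{k}|$, $\mathrm{Cl}_{\mathbf{k}}(\pi/3)\in\mathrm{span}_{\mathbb{Q}}S^o_{k,n}$ and $\mathrm{Gl}_{\mathbf{k}}(\pi/3)\in\mathrm{span}_{\mathbb{Q}}S^e_{k,n}$. Then for every $\mathbf{k}=(k_1,\dots,k_n)\in\mathbb{N}^n$ and $\mathbf{l}\in(\mathbb{Z}_{\ge0})^n$ with $k_u-1-l_u\ge0$ for all $u$, setting $d=\sum_{u}(k_u-1-l_u)$: if $d$ is odd then $\mathrm{Ls}_{\mathbf{k}}^{\mathbf{l}}(\pi/3)\in\mathrm{span}_{\mathbb{Q}}S^o_{|\mathbf{k}|,d}$, and if $d$ is even then $\mathrm{Ls}_{\mathbf{k}}^{\mathbf{l}}(\pi/3)\in\mathrm{span}_{\mathbb{Q}}S^e_{|\mathbf{k}|,d}$.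
   Context: $A(\theta)=\log|2\sin(\theta/2)|$; $\mathrm{Ls}_{\mathbf{k}}^{\mathbf{l}}(\sigma)=(-1)^n\int_0^{\sigma}\int_0^{\theta_n}\cdots\int_0^{\theta_2}\prod_{u=1}^n\theta_u^{l_u}A(\theta_u)^{k_u-1-l_u}\,d\theta_1\cdots d\theta_n$, $\mathrm{Ls}_\emptyset^\emptyset=1$; $|\mathbf{k}|=\sum k_u$. An index is admissible if its last entry is $\ge2$ (the empty index is admissible). $\zeta(k_1,\dots,k_n)=\sum_{0<m_1<\dots<m_n}m_1^{-k_1}\cdots m_n^{-k_n}$, $\zeta(\emptyset)=1$. $\mathrm{Li}_{k_1,\dots,k_n}(z)=\sum_{0<m_1<\dots<m_n}\frac{z^{m_n}}{m_1^{k_1}\cdots m_n^{k_n}}$ (continued holomorphically to $\mathbb{C}\setminus[1,\infty)$ and to $|z|=1$, $z\ne1$), $\mathrm{Li}_\emptyset=1$. $\mathrm{Cl}_{\mathbf{k}}(\sigma)=\mathrm{Im}\,\mathrm{Li}_{\mathbf{k}}(e^{i\sigma})$ if $|\mathbf{k}|$ even, $\mathrm{Re}$ if odd; $\mathrm{Gl}_{\mathbf{k}}(\sigma)=\mathrm{Re}\,\mathrm{Li}_{\mathbf{k}}(e^{i\sigma})$ if $|\mathbf{k}|$ even, $\mathrm{Im}$ if odd. For $k_u\ge2$, $\mathrm{SLs}(k_1,\dots,k_n)=\int_0^{\pi/3}\int_0^{\theta_n}\cdots\int_0^{\theta_2}\prod_{u=1}^n(\theta_u-\pi/3)^{k_u-2}A(\theta_u)\,d\theta_1\cdots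 d\theta_n$, $\mathrm{SLs}(\emptyset)=1$. For $k,d\ge0$: $S'_{k,d}=\{\pi^{2m}\mathrm{SLs}(k_1,\dots,k_n): 2m+\sum k_i=k,\ m\ge0,\ 0\le n\le d,\ k_i\ge3\text{ odd}\}$; $S^o_{k,d}=\{\pi^m\mathrm{SLs}(k_1,\dots,k_n): m+\sum k_i=k,\ m\ge0,\ 0\le n\le d,\ n\text{ odd},\ k_i\ge2\}$; $S^e_{k,d}$ is the same with $n$ even. *)

theory Defs
  imports "HOL-Analysis.Analysis"
begin

definition A_fun :: "real \<Rightarrow> real" where
  "A_fun \<theta> = ln \<bar>2 * sin (\<theta> / 2)\<bar>"

text \<open>Iterated integral over 0 < theta_1 < ... < theta_n < sigma.
  iter_int_rev takes the integrands in the order [f_n, ..., f_1] (outermost first).\<close>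
primrec iter_int_rev :: "(real \<Rightarrow> real) list \<Rightarrow> real \<Rightarrow> real" where
  "iter_int_rev [] \<sigma> = 1"
| "iter_int_rev (f # fs) \<sigma> = integral {0..\<sigma>} (\<lambda>t. f t * iter_int_rev fs t)"

definition iter_int :: "(real \<Rightarrow> real) list \<Rightarrow> real \<Rightarrow> real" where
  "iter_int fs \<sigma> = iter_int_rev (rev fs) \<sigma>"

definition Ls :: "nat list \<Rightarrow> nat list \<Rightarrow> real \<Rightarrow> real" where
  "Ls ks ls \<sigma> = (-1) ^ length ks *
     iter_int (map2 (\<lambda>k l \<theta>. \<theta> ^ l * A_fun \<theta> ^ (k - 1 - l)) ks ls) \<sigma>"

text \<open>SLs(k_1,...,k_n), for k_u >= 2.\<close>
definition SLs :: "nat list \<Rightarrow> real" where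
  "SLs ks = iter_int (map (\<lambda>k \<theta>. (\<theta> - pi/3) ^ (k - 2) * A_fun \<theta>) ks) (pi/3)"

definition incr_tuples :: "nat \<Rightarrow> nat list set" where
  "incr_tuples n = {ms. length ms = n \<and> sorted_wrt (<) ms \<and> (\<forall>m\<in>set ms. 0 < m)}"

definition admissible :: "nat list \<Rightarrow> bool" where
  "admissible ks \<longleftrightarrow> ks = [] \<or> last ks \<ge> 2"

definition mzv :: "nat list \<Rightarrow> real" where
  "mzv ks = infsum (\<lambda>ms. \<Prod>i<length ks. 1 / real (ms ! i) ^ (ks ! i)) (incr_tuples (length ks))"

text \<open>Multiple polylogarithm as a power series (used for |z| < 1).\<close>
definition Li_disk :: "nat list \<Rightarrow> complex \<Rightarrow> complex" where
  "Li_disk ks z = (if ks = [] then 1 else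
     infsum (\<lambda>ms. z ^ last ms / (\<Prod>i<length ks. of_nat (ms ! i) ^ (ks ! i))) (incr_tuples (length ks)))"

text \<open>Value on the unit circle at e^{i sigma} (sigma not a multiple of 2 pi):
  the boundary value of the holomorphic function, taken as the radial limit.\<close>
definition Li_circ :: "nat list \<Rightarrow> real \<Rightarrow> complex" where
  "Li_circ ks \<sigma> = Lim (at_left 1) (\<lambda>r::real. Li_disk ks (of_real r * cis \<sigma>))"

definition Cl :: "nat list \<Rightarrow> real \<Rightarrow> real" where
  "Cl ks \<sigma> = (if even (sum_list ks) then Im (Li_circ ks \<sigma>) else Re (Li_circ ks \<sigma>))"

definition Gl :: "nat list \<Rightarrow> real \<Rightarrow> real" where
  "Gl ks \<sigma> = (if even (sum_list ks) then Re (Li_circ ks \<sigma>) else Im (Li_circ ks \<sigma>))"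

definition qspan :: "real set \<Rightarrow> real set" where
  "qspan S = {x. \<exists>F c. finite F \<and> F \<subseteq> S \<and> (\<forall>s\<in>F. c s \<in> \<rat>) \<and> x = (\<Sum>s\<in>F. c s * s)}"

definition S' :: "nat \<Rightarrow> nat \<Rightarrow> real set" where
  "S' k d = {pi ^ (2 * m) * SLs ks | m ks.
      2 * m + sum_list ks = k \<and> length ks \<le> d \<and> (\<forall>x\<in>set ks. 3 \<le> x \<and> odd x)}"

definition S_o :: "nat \<Rightarrow> nat \<Rightarrow> real set" where
  "S_o k d = {pi ^ m * SLs ks | m ks.
      m + sum_list ks = k \<and> length ks \<le> d \<and> odd (length ks) \<and> (\<forall>x\<in>set ks. 2 \<le> x)}"

definition S_e :: "nat \<Rightarrow> nat \<Rightarrow> real set" where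
  "S_e k d = {pi ^ m * SLs ks | m ks.
      m + sum_list ks = k \<and> length ks \<le> d \<and> even (length ks) \<and> (\<forall>x\<in>set ks. 2 \<le> x)}"

end

theory Submission
  imports Defs
begin

text \<open>
  For \<open>0 < t < 2 * pi\<close> one has \<open>-Li_1 (cis t) = A_fun t + \<i> * (t - pi) / 2\<close>, so \<open>A_fun\<close> is a polynomial
  in \<open>Li_1 (cis t)\<close>, \<open>\<i> * t\<close> and \<open>\<i> * pi\<close>. Rational combinations of
  \<open>(\<i> * pi) ^ a * (\<i> * t) ^ b * mzv \<cdot> ... \<cdot> mzv * Li k (cis t)\<close> are stable under multiplication by
  \<open>Li_1\<close> (shuffle product) and, by partial integration, under integration against \<open>\<i> dt\<close>; the integration
  constants are multiple zeta values. Hence the iterated log-sine integral, multiplied by a suitable power of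
  \<open>\<i>\<close>, is such a combination, homogeneous in weight and depth. At \<open>t = pi/3\<close> the hypotheses
  replace all factors by values of \<open>SLs\<close>, whose products are again expanded by shuffles. If \<open>\<i> * pi\<close>,
  \<open>mzv\<close> and \<open>Li\<close> of weight \<open>k\<close> are multiplied by \<open>\<i> ^ k\<close>, all of them have real part in the
  span of \<open>S_e\<close> and imaginary part in the span of \<open>S_o\<close>, which yields the parity statement.

  To avoid convergence problems on the unit circle, the computation is done on the circle of radius \<open>r < 1\<close>,
  where \<open>Li\<close> is a convergent power series, and the limit \<open>r \<rightarrow> 1\<close> is taken at the end by dominated convergence.
\<close>

section \<open>Multiple polylogarithms as power series\<close>

text \<open>
  From here on indices are often stored in reversed order, with the entry of the largest summation variable
  first: \<open>mzv_below\<close>, \<open>Li_coeff\<close>, \<open>Li_fps\<close> and \<open>Li_rev\<close> take \<open>[k_n, ..., k_1]\<close>. The coefficient with \<open>m = 0\<close>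
  vanishes for positive entries because of \<open>x / 0 = 0\<close>.
\<close>

primrec mzv_below :: "nat list \<Rightarrow> nat \<Rightarrow> real" where
  "mzv_below [] N = 1"
| "mzv_below (k # ks) N = (\<Sum>m\<in>{1..<N}. mzv_below ks m / real m ^ k)"

fun Li_coeff :: "nat list \<Rightarrow> nat \<Rightarrow> real" where
  "Li_coeff [] m = (if m = 0 then 1 else 0)"
| "Li_coeff (k # ks) m = mzv_below ks m / real m ^ k"

definition Li_fps :: "nat list \<Rightarrow> complex fps" where
  "Li_fps ks = Abs_fps (\<lambda>m. of_real (Li_coeff ks m))"

lemma Li_fps_nth [simp]: "fps_nth (Li_fps ks) m = of_real (Li_coeff ks m)"
  by (simp add: Li_fps_def)

lemma Li_fps_Nil [simp]: "Li_fps [] = 1"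
  by (rule fps_ext) simp

section \<open>Growth of the coefficients and convergence\<close>

lemma mzv_below_nonneg: "0 \<le> mzv_below ks N"
  by (induction ks arbitrary: N) (auto intro!: sum_nonneg)

lemma Li_coeff_nonneg: "0 \<le> Li_coeff ks m"
  by (cases ks) (auto simp: mzv_below_nonneg)

text \<open>Telescoping: for consecutive square roots \<open>a\<close> and \<open>b\<close>, the
  bound of \<open>2 * a * b\<close> by the sum of squares, which is twice the square of
  \<open>b\<close> minus \<open>1\<close>, gives \<open>1 / b \<le> 2 * b - 2 * a\<close>.\<close>

lemma sum_inverse_sqrt_le: "(\<Sum>m\<in>{1..<Suc N}. 1 / sqrt (real m)) \<le> 2 * sqrt (real N)"
proof (induction N)
  case (Suc N)
  define a b where "a = sqrt (real N)" and "b = sqrt (real (Suc N))"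
  have ab: "0 \<le> a" "0 < b" "b\<^sup>2 = a\<^sup>2 + 1"
    by (auto simp: a_def b_def)
  have "2 * a * b \<le> a\<^sup>2 + b\<^sup>2"
    by (rule sum_squares_bound)
  hence "1 / b \<le> 2 * b - 2 * a"
    using ab by (simp add: field_simps power2_eq_square)
  with Suc show ?case by (simp add: a_def b_def)
qed auto

text \<open>A square root stands in for the true growth, at most a power of a logarithm, because it
  reproduces itself: each level sums \<open>sqrt m / m = 1 / sqrt m\<close> and costs only a factor
  \<open>2\<close>.\<close>

lemma mzv_below_le_sqrt:
  assumes "\<forall>k\<in>set ks. 1 \<le> k" "1 \<le> N"
  shows "mzv_below ks N \<le> 2 ^ length ks * sqrt (real N)"
  using assms
proof (induction ks arbitrary: N)
  case (Cons k ks)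
  have "mzv_below (k # ks) N \<le> (\<Sum>m\<in>{1..<N}. 2 ^ length ks * (1 / sqrt (real m)))"
    unfolding mzv_below.simps
  proof (rule sum_mono)
    fix m assume m: "m \<in> {1..<N}"
    have "mzv_below ks m / real m ^ k \<le> mzv_below ks m / real m"
      using m Cons.prems self_le_power[of "real m" k]
      by (intro divide_left_mono mzv_below_nonneg) auto
    also have "\<dots> \<le> (2 ^ length ks * sqrt (real m)) / real m"
      using m Cons by (intro divide_right_mono) auto
    also have "\<dots> = 2 ^ length ks * (1 / sqrt (real m))"
      using m by (simp add: field_simps)
    finally show "mzv_below ks m / real m ^ k \<le> 2 ^ length ks * (1 / sqrt (real m))" .
  qed
  also have "\<dots> = 2 ^ length ks * (\<Sum>m\<in>{1..<N}. 1 / sqrt (real m))"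
    by (simp add: sum_distrib_left)
  also have "\<dots> \<le> 2 ^ length ks * (2 * sqrt (real (N - 1)))"
    using sum_inverse_sqrt_le[of "N - 1"] Cons.prems by (intro mult_left_mono) auto
  also have "\<dots> \<le> 2 ^ length (k # ks) * sqrt (real N)"
    by simp
  finally show ?case .
qed auto

text \<open>The denominator absorbs the square root. Bounded coefficients give a radius of
  convergence of at least \<open>1\<close>.\<close>

lemma Li_coeff_le:
  assumes "\<forall>k\<in>set ks. 1 \<le> k"
  shows "Li_coeff ks m \<le> 2 ^ length ks"
proof (cases ks)
  case (Cons k ks')
  show ?thesis
  proof (cases "m = 0")
    case False
    have "mzv_below ks' m \<le> 2 ^ length ks' * sqrt (real m)"
      using assms Cons False by (intro mzv_below_le_sqrt) auto
    also have "\<dots> \<le> 2 ^ length ks * real m ^ k"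
    proof (intro mult_mono)
      have "sqrt (real m) \<le> real m"
        using False by (intro real_le_lsqrt) (auto simp: power2_eq_square)
      also have "\<dots> \<le> real m ^ k"
        using assms Cons False by (intro self_le_power) auto
      finally show "sqrt (real m) \<le> real m ^ k" .
    qed (auto simp: Cons)
    finally show ?thesis using Cons False by (simp add: field_simps)
  qed (use assms Cons in \<open>auto simp: power_0_left\<close>)
qed auto

text \<open>A leading exponent of at least \<open>2\<close> leaves the convergent majorant
  \<open>m powr (-3/2)\<close>; this gives absolute convergence on the closed unit disk.\<close>

lemma Li_coeff_summable:
  assumes "\<forall>k\<in>set ks. 1 \<le> k" "2 \<le> k"
  shows "summable (Li_coeff (k # ks))"
proof (rule summable_comparison_test')
  show "summable (\<lambda>m. 2 ^ length ks * real m powr (-3/2))"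
    by (intro summable_mult) (simp add: summable_real_powr_iff)
next
  fix m :: nat assume m: "1 \<le> m"
  have "mzv_below ks m / real m ^ k \<le> (2 ^ length ks * sqrt (real m)) / real m ^ 2"
    using m assms mzv_below_le_sqrt[of ks m]
    by (intro frac_le mzv_below_nonneg power_increasing) auto
  also have "\<dots> = 2 ^ length ks * real m powr (-3/2)"
  proof -
    have "sqrt (real m) / real m ^ 2 = real m powr (1/2) / real m powr 2"
      using m by (simp add: powr_half_sqrt)
    also have "\<dots> = real m powr (-3/2)"
      using m powr_diff[of "real m" "1/2" 2] by simp
    finally show ?thesis by (metis times_divide_eq_right)
  qed
  finally show "norm (Li_coeff (k # ks) m) \<le> 2 ^ length ks * real m powr (-3/2)"
    by (simp add: mzv_below_nonneg)
qed

lemma Li_fps_radius: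
  assumes "\<forall>k\<in>set ks. 1 \<le> k"
  shows "1 \<le> fps_conv_radius (Li_fps ks)"
  unfolding fps_conv_radius_def one_ereal_def
proof (rule conv_radius_geI_ex')
  fix r :: real assume r: "0 < r" "ereal r < ereal 1"
  show "summable (\<lambda>n. fps_nth (Li_fps ks) n * of_real r ^ n)"
  proof (rule summable_comparison_test')
    show "summable (\<lambda>n. 2 ^ length ks * r ^ n)"
      using r by (intro summable_mult summable_geometric) auto
    show "norm (fps_nth (Li_fps ks) n * of_real r ^ n) \<le> 2 ^ length ks * r ^ n" if "n \<ge> 0" for n
      using r Li_coeff_le[OF assms, of n] Li_coeff_nonneg[of ks n]
      by (auto simp: norm_mult norm_power intro!: mult_right_mono)
  qed
qed

lemma Li_fps_conv:
  assumes "\<forall>k\<in>set ks. 1 \<le> k" "norm z < 1"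
  shows "ereal (norm z) < fps_conv_radius (Li_fps ks)"
  using Li_fps_radius[OF assms(1)] assms(2)
  by (metis ereal_less(3) less_le_trans)

section \<open>Differential equations and the shuffle product with \<open>Li_1\<close>\<close>

lemma Li_fps_deriv_Suc:
  assumes "1 \<le> k"
  shows "fps_X * fps_deriv (Li_fps (Suc k # ks)) = Li_fps (k # ks)"
proof (rule fps_ext)
  fix n show "fps_nth (fps_X * fps_deriv (Li_fps (Suc k # ks))) n = fps_nth (Li_fps (k # ks)) n"
    using assms by (cases n) (auto simp: power_0_left simp flip: of_nat_Suc)
qed

text \<open>The derivative has the coefficients \<open>mzv_below ks (Suc n)\<close>. Multiplication
  by \<open>1 - fps_X\<close> takes their successive differences, and these are the coefficients of
  \<open>Li_fps ks\<close>.\<close>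

lemma Li_fps_deriv_1:
  assumes "\<forall>k\<in>set ks. 1 \<le> k"
  shows "(1 - fps_X) * fps_deriv (Li_fps (1 # ks)) = Li_fps ks"
proof (rule fps_ext)
  fix n
  have D: "fps_nth (fps_deriv (Li_fps (1 # ks))) n = of_real (mzv_below ks (Suc n))" for n ks
    by (simp flip: of_nat_Suc)
  show "fps_nth ((1 - fps_X) * fps_deriv (Li_fps (1 # ks))) n = fps_nth (Li_fps ks) n"
  proof (cases n)
    case 0
    thus ?thesis using assms by (cases ks) (auto simp: algebra_simps power_0_left)
  next
    case (Suc m)
    thus ?thesis using assms by (cases ks) (auto simp: algebra_simps D[unfolded One_nat_def] simp del: fps_deriv_nth)
  qed
qed

lemma Li_fps_nth_0 [simp]: "1 \<le> k \<Longrightarrow> fps_nth (Li_fps (k # ks)) 0 = 0"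
  by (simp add: power_0_left)

lemma fps_deriv_eqI:
  fixes f g :: "complex fps"
  assumes "fps_nth f 0 = fps_nth g 0" "fps_deriv f = fps_deriv g"
  shows "f = g"
  using assms fps_deriv_eq_iff[of f g] by auto

lemma fps_deriv_sum_list: "fps_deriv (\<Sum>x\<leftarrow>xs. f x) = (\<Sum>x\<leftarrow>xs. fps_deriv (f x :: complex fps))"
  by (induction xs) auto

lemma fps_nth_sum_list: "fps_nth (\<Sum>x\<leftarrow>xs. f x) n = (\<Sum>x\<leftarrow>xs. fps_nth (f x :: complex fps) n)"
  by (induction xs) auto

definition is_index :: "nat \<Rightarrow> nat \<Rightarrow> nat list \<Rightarrow> bool" where
  "is_index w d ks \<longleftrightarrow> (\<forall>k\<in>set ks. 1 \<le> k) \<and> sum_list ks = w \<and> length ks = d"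

text \<open>Both sides have constant term \<open>0\<close> and equal derivatives, by the product
  rule, the two differential equations and the induction hypothesis for an index with its leading
  entry removed or lowered. Products with \<open>Li_1\<close> suffice, since these are what the
  factors \<open>A_disk\<close> bring in.\<close>

lemma Li_fps_shuffle_1:
  assumes "\<forall>k\<in>set ks. 1 \<le> k"
  shows "\<exists>js. (\<forall>j\<in>set js. is_index (Suc (sum_list ks)) (Suc (length ks)) j) \<and>
           Li_fps [1] * Li_fps ks = (\<Sum>j\<leftarrow>js. Li_fps j)"
  using assms
proof (induction "sum_list ks + length ks" arbitrary: ks rule: less_induct)
  case (less ks)
  have X0: "(1 - fps_X :: complex fps) \<noteq> 0" 
    by (metis diff_zero fps_X_nth fps_one_nth fps_sub_nth fps_zero_nth zero_neq_one)
  have L1: "fps_nth (Li_fps [1]) 0 = 0" by simp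
  show ?case
  proof (cases ks)
    case Nil
    thus ?thesis by (intro exI[of _ "[[1]]"]) (auto simp: is_index_def)
  next
    case (Cons k ks')
    have pos': "\<forall>k\<in>set ks'. 1 \<le> k" "1 \<le> k" using less.prems Cons by auto
    show ?thesis
    proof (cases "k = 1")
      case True
      obtain js where js: "\<forall>j\<in>set js. is_index (Suc (sum_list ks')) (Suc (length ks')) j"
        "Li_fps [1] * Li_fps ks' = (\<Sum>j\<leftarrow>js. Li_fps j)"
        using less.hyps[of ks'] pos' Cons by auto
      have eq: "Li_fps [1] * Li_fps ks = (\<Sum>j\<leftarrow>ks # js. Li_fps (1 # j))"
      proof (rule fps_deriv_eqI)
        show "fps_nth (Li_fps [1] * Li_fps ks) 0 = fps_nth (\<Sum>j\<leftarrow>ks # js. Li_fps (1 # j)) 0"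
          unfolding fps_nth_sum_list by simp
        \<comment> \<open>The factor \<open>1 - fps_X\<close> turns the derivative of every series
          with leading entry \<open>1\<close> into the series with that entry removed; it is
          cancelled at the end.\<close>
        have "(1 - fps_X) * fps_deriv (Li_fps [1] * Li_fps ks) =
              ((1 - fps_X) * fps_deriv (Li_fps [1])) * Li_fps ks + Li_fps [1] * ((1 - fps_X) * fps_deriv (Li_fps ks))"
          by (simp add: algebra_simps)
        also have "\<dots> = Li_fps ks + (\<Sum>j\<leftarrow>js. Li_fps j)"
          using Li_fps_deriv_1[of "[]"] Li_fps_deriv_1[of ks'] pos' js(2) Cons True by simp
        also have "\<dots> = (\<Sum>j\<leftarrow>ks # js. (1 - fps_X) * fps_deriv (Li_fps (1 # j)))"
        proof -
          have "map Li_fps (ks # js) = map (\<lambda>j. (1 - fps_X) * fps_deriv (Li_fps (1 # j))) (ks # js)"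
            using js(1) less.prems Li_fps_deriv_1 by (intro map_cong refl) (auto simp: is_index_def)
          thus ?thesis by (metis list.simps(9) sum_list.Cons)
        qed
        also have "\<dots> = (1 - fps_X) * fps_deriv (\<Sum>j\<leftarrow>ks # js. Li_fps (1 # j))"
          unfolding fps_deriv_sum_list sum_list_const_mult ..
        finally show "fps_deriv (Li_fps [1] * Li_fps ks) = fps_deriv (\<Sum>j\<leftarrow>ks # js. Li_fps (1 # j))"
          using X0 by simp
      qed
      show ?thesis
        using js(1) less.prems Cons True
        by (intro exI[of _ "map (\<lambda>j. 1 # j) (ks # js)"])
           (auto simp: is_index_def eq[unfolded Cons True One_nat_def] o_def)
    next
      case False
      then obtain b where b: "k = Suc b" "1 \<le> b" using pos'
        by (metis One_nat_def Suc_le_D le_antisym not_less_eq_eq)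
      obtain js where js: "\<forall>j\<in>set js. is_index (Suc (sum_list (b # ks'))) (Suc (length (b # ks'))) j"
        "Li_fps [1] * Li_fps (b # ks') = (\<Sum>j\<leftarrow>js. Li_fps j)"
        using less.hyps[of "b # ks'"] pos' Cons b by auto
      \<comment> \<open>Raising the leading entry inverts the operator
        \<open>fps_X * fps_deriv\<close>. The lists in \<open>js\<close> are nonempty because their
        length is positive.\<close>
      define inc where "inc = (\<lambda>j :: nat list. Suc (hd j) # tl j)"
      have inc: "fps_X * fps_deriv (Li_fps (inc j)) = Li_fps j" "fps_nth (Li_fps (inc j)) 0 = 0"
         "is_index (Suc (sum_list ks)) (Suc (length ks)) (inc j)" if "j \<in> set js" for j
      proof -
        have "is_index (Suc (sum_list (b # ks'))) (Suc (length (b # ks'))) j" using js(1) that by blast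
        thus "fps_X * fps_deriv (Li_fps (inc j)) = Li_fps j" "fps_nth (Li_fps (inc j)) 0 = 0"
         "is_index (Suc (sum_list ks)) (Suc (length ks)) (inc j)"
          using Li_fps_deriv_Suc by (cases j; auto simp: is_index_def inc_def Cons b)+
      qed
      have eq: "Li_fps [1] * Li_fps ks = Li_fps (1 # ks) + (\<Sum>j\<leftarrow>js. Li_fps (inc j))"
      proof (rule fps_deriv_eqI)
        have "(\<Sum>j\<leftarrow>js. fps_nth (Li_fps (inc j)) 0) = (\<Sum>j\<leftarrow>js. 0)"
          using inc(2) by (intro arg_cong[where f = sum_list] map_cong) auto
        thus "fps_nth (Li_fps [1] * Li_fps ks) 0 = fps_nth (Li_fps (1 # ks) + (\<Sum>j\<leftarrow>js. Li_fps (inc j))) 0"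
          by (simp add: fps_nth_sum_list del: Li_fps_nth)
        have "fps_X * (\<Sum>j\<leftarrow>js. fps_deriv (Li_fps (inc j))) = (\<Sum>j\<leftarrow>js. fps_X * fps_deriv (Li_fps (inc j)))"
          by (simp add: sum_list_const_mult)
        also have "\<dots> = (\<Sum>j\<leftarrow>js. Li_fps j)"
          using inc(1) by (intro arg_cong[where f = sum_list] map_cong) auto
        finally have S: "fps_X * (\<Sum>j\<leftarrow>js. fps_deriv (Li_fps (inc j))) = (\<Sum>j\<leftarrow>js. Li_fps j)" .
        \<comment> \<open>The two factors of the product satisfy different equations, so both
          \<open>fps_X\<close> and \<open>1 - fps_X\<close> are multiplied in and cancelled
          later.\<close>
        have "(1 - fps_X) * (fps_X * fps_deriv (Li_fps [1] * Li_fps ks)) =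
              fps_X * (((1 - fps_X) * fps_deriv (Li_fps [1])) * Li_fps ks) + (1 - fps_X) * (Li_fps [1] * (fps_X * fps_deriv (Li_fps ks)))"
          by (simp add: algebra_simps)
        also have "\<dots> = fps_X * Li_fps ks + (1 - fps_X) * (\<Sum>j\<leftarrow>js. Li_fps j)"
          using Li_fps_deriv_1[of "[]"] Li_fps_deriv_Suc[of b ks'] js(2) Cons b by simp
        also have "\<dots> = fps_X * ((1 - fps_X) * fps_deriv (Li_fps (1 # ks))) + (1 - fps_X) * (fps_X * (\<Sum>j\<leftarrow>js. fps_deriv (Li_fps (inc j))))"
          using Li_fps_deriv_1[of ks] less.prems S by simp
        also have "\<dots> = (1 - fps_X) * (fps_X * fps_deriv (Li_fps (1 # ks) + (\<Sum>j\<leftarrow>js. Li_fps (inc j))))"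
          by (simp add: algebra_simps fps_deriv_sum_list)
        finally show "fps_deriv (Li_fps [1] * Li_fps ks) = fps_deriv (Li_fps (1 # ks) + (\<Sum>j\<leftarrow>js. Li_fps (inc j)))"
          using X0 by simp
      qed
      show ?thesis
        using inc(3) less.prems
        by (intro exI[of _ "(1 # ks) # map inc js"])
           (auto simp: is_index_def eq[unfolded One_nat_def] o_def)
    qed
  qed
qed

section \<open>Evaluation in the open unit disk\<close>

abbreviation Li_rev :: "nat list \<Rightarrow> complex \<Rightarrow> complex" where
  "Li_rev ks \<equiv> eval_fps (Li_fps ks)"

lemma Li_rev_deriv:
  assumes "\<forall>k\<in>set ks. 1 \<le> k" "norm z < 1"
  shows "(Li_rev ks has_field_derivative eval_fps (fps_deriv (Li_fps ks)) z) (at z within S)"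
  by (rule has_field_derivative_eval_fps) (use Li_fps_conv assms in blast)

lemma Li_rev_deriv_Suc:
  assumes "\<forall>k\<in>set ks. 1 \<le> k" "1 \<le> k" "norm z < 1"
  shows "z * eval_fps (fps_deriv (Li_fps (Suc k # ks))) z = Li_rev (k # ks) z"
proof -
  have "ereal (norm z) < fps_conv_radius (Li_fps (Suc k # ks))"
    using assms by (intro Li_fps_conv) auto
  also have "\<dots> \<le> fps_conv_radius (fps_deriv (Li_fps (Suc k # ks)))"
    by (rule fps_conv_radius_deriv)
  finally show ?thesis
    unfolding Li_fps_deriv_Suc[OF assms(2), of ks, symmetric]
    by (subst eval_fps_mult) auto
qed

lemma Li_rev_deriv_1:
  assumes "\<forall>k\<in>set ks. 1 \<le> k" "norm z < 1"
  shows "(1 - z) * eval_fps (fps_deriv (Li_fps (1 # ks))) z = Li_rev ks z"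
proof -
  have "ereal (norm z) < fps_conv_radius (Li_fps (1 # ks))"
    using assms by (intro Li_fps_conv) auto
  also have "\<dots> \<le> fps_conv_radius (fps_deriv (Li_fps (1 # ks)))"
    by (rule fps_conv_radius_deriv)
  finally have *: "ereal (norm z) < fps_conv_radius (fps_deriv (Li_fps (1 # ks)))" .
  have "fps_conv_radius (1 - fps_X :: complex fps) = \<infinity>"
    using fps_conv_radius_diff[of 1 "fps_X :: complex fps"] by simp
  thus ?thesis using *
    unfolding Li_fps_deriv_1[OF assms(1), symmetric]
    by (subst eval_fps_mult) (auto simp: eval_fps_diff)
qed

text \<open>Convergence is carried through the induction because evaluation is additive only inside
  both disks of convergence.\<close>

lemma eval_sum_list_Li_fps:
  assumes "\<forall>j\<in>set js. \<forall>k\<in>set j. 1 \<le> k" "norm z < 1"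
  shows "ereal (norm z) < fps_conv_radius (\<Sum>j\<leftarrow>js. Li_fps j) \<and>
         eval_fps (\<Sum>j\<leftarrow>js. Li_fps j) z = (\<Sum>j\<leftarrow>js. Li_rev j z)"
  using assms
proof (induction js)
  case (Cons j js)
  have j: "ereal (norm z) < fps_conv_radius (Li_fps j)"
    using Cons.prems by (intro Li_fps_conv) auto
  have js: "ereal (norm z) < fps_conv_radius (\<Sum>j\<leftarrow>js. Li_fps j)"
    "eval_fps (\<Sum>j\<leftarrow>js. Li_fps j) z = (\<Sum>j\<leftarrow>js. Li_rev j z)"
    using Cons by auto
  have "ereal (norm z) < min (fps_conv_radius (Li_fps j)) (fps_conv_radius (\<Sum>j\<leftarrow>js. Li_fps j))"
    using j js by simp
  also have "\<dots> \<le> fps_conv_radius (Li_fps j + (\<Sum>j\<leftarrow>js. Li_fps j))"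
    by (rule fps_conv_radius_add)
  finally show ?case using j js by (simp add: eval_fps_add)
qed auto

lemma Li_rev_shuffle_1:
  assumes "\<forall>k\<in>set ks. 1 \<le> k"
  shows "\<exists>js. (\<forall>j\<in>set js. is_index (Suc (sum_list ks)) (Suc (length ks)) j) \<and>
           (\<forall>z. norm z < 1 \<longrightarrow> Li_rev [1] z * Li_rev ks z = (\<Sum>j\<leftarrow>js. Li_rev j z))"
proof -
  obtain js where js: "\<forall>j\<in>set js. is_index (Suc (sum_list ks)) (Suc (length ks)) j"
    "Li_fps [1] * Li_fps ks = (\<Sum>j\<leftarrow>js. Li_fps j)"
    using Li_fps_shuffle_1[OF assms] by blast
  have "Li_rev [1] z * Li_rev ks z = (\<Sum>j\<leftarrow>js. Li_rev j z)" if z: "norm z < 1" for z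
    using eval_sum_list_Li_fps[of js z] js Li_fps_conv[OF _ z, of "[1]"] Li_fps_conv[OF assms z] z
    by (simp add: is_index_def flip: js(2) eval_fps_mult)
  thus ?thesis using js(1) by blast
qed

text \<open>The logarithm series. This identity makes \<open>A_disk\<close> a combination of
  \<open>Li_1\<close> and the angle.\<close>

lemma Li_rev_1:
  assumes "norm z < 1"
  shows "Li_rev [1] z = - Ln (1 - z)"
proof -
  have "(\<lambda>n. - ((-(-z))^n) / of_nat n) sums ln (1 + (-z))"
    by (rule Ln_series') (use assms in auto)
  hence "(\<lambda>n. - (- (z ^ n) / of_nat n)) sums - ln (1 - z)"
    by (intro sums_minus) simp
  hence "(\<lambda>n. fps_nth (Li_fps [1]) n * z ^ n) sums - ln (1 - z)"
    by (simp add: field_simps)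
  thus ?thesis unfolding eval_fps_def by (simp add: sums_iff)
qed

section \<open>Multiple zeta values and boundary values\<close>

definition incr_tuples_below :: "nat \<Rightarrow> nat \<Rightarrow> nat list set" where
  "incr_tuples_below n N = {ms \<in> incr_tuples n. \<forall>m\<in>set ms. m < N}"

definition mzv_term :: "nat list \<Rightarrow> nat list \<Rightarrow> real" where
  "mzv_term ks ms = (\<Prod>i<length ks. 1 / real (ms ! i) ^ (ks ! i))"

lemma mzv_term_nonneg: "0 \<le> mzv_term ks ms"
  unfolding mzv_term_def by (intro prod_nonneg) auto

lemma mzv_term_snoc:
  assumes "length ms = length ks"
  shows "mzv_term (ks @ [k]) (ms @ [m]) = mzv_term ks ms / real m ^ k"
  using assms by (simp add: mzv_term_def nth_append)

lemma finite_incr_tuples_below: "finite (incr_tuples_below n N)"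
proof (rule finite_subset)
  show "incr_tuples_below n N \<subseteq> {ms. set ms \<subseteq> {..<N} \<and> length ms = n}"
    by (auto simp: incr_tuples_below_def incr_tuples_def)
qed (rule finite_lists_length_eq, simp)

lemma incr_tuples_Suc:
  "incr_tuples (Suc n) = (\<lambda>(m, ms). ms @ [m]) ` Sigma {1..} (incr_tuples_below n)"
proof (intro equalityI subsetI)
  fix xs assume xs: "xs \<in> incr_tuples (Suc n)"
  then obtain ms m where "xs = ms @ [m]"
    by (cases xs rule: rev_cases) (auto simp: incr_tuples_def)
  with xs show "xs \<in> (\<lambda>(m, ms). ms @ [m]) ` Sigma {1..} (incr_tuples_below n)"
    by (intro image_eqI[of _ _ "(m, ms)"])
       (auto simp: incr_tuples_def incr_tuples_below_def sorted_wrt_append)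
qed (auto simp: incr_tuples_def incr_tuples_below_def sorted_wrt_append)

lemma incr_tuples_below_Suc:
  "incr_tuples_below (Suc n) N = (\<lambda>(m, ms). ms @ [m]) ` Sigma {1..<N} (incr_tuples_below n)"
  unfolding incr_tuples_below_def[of "Suc n"] incr_tuples_Suc
  by (force simp: incr_tuples_below_def)

lemma incr_tuples_below_0: "incr_tuples_below 0 N = {[]}"
  by (auto simp: incr_tuples_below_def incr_tuples_def)

lemma inj_snoc: "inj_on (\<lambda>(m, ms). ms @ [m]) S"
  by (auto simp: inj_on_def)

lemma length_incr_tuples_below: "ms \<in> incr_tuples_below n N \<Longrightarrow> length ms = n"
  by (simp add: incr_tuples_below_def incr_tuples_def)

text \<open>The recursion peels off the largest summation variable first, whence the
  reversal.\<close>

lemma mzv_below_eq_sum: "mzv_below (rev ks) N = (\<Sum>ms\<in>incr_tuples_below (length ks) N. mzv_term ks ms)"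
proof (induction ks arbitrary: N rule: rev_induct)
  case Nil
  thus ?case by (simp add: incr_tuples_below_0 mzv_term_def)
next
  case (snoc k ks)
  have "(\<Sum>ms\<in>incr_tuples_below (length (ks @ [k])) N. mzv_term (ks @ [k]) ms) =
        (\<Sum>(m, ms)\<in>Sigma {1..<N} (incr_tuples_below (length ks)). mzv_term (ks @ [k]) (ms @ [m]))"
    unfolding length_append_singleton incr_tuples_below_Suc
    by (subst sum.reindex[OF inj_snoc]) (auto intro!: sum.cong)
  also have "\<dots> = (\<Sum>m\<in>{1..<N}. \<Sum>ms\<in>incr_tuples_below (length ks) m. mzv_term (ks @ [k]) (ms @ [m]))"
    by (subst sum.Sigma) (auto simp: finite_incr_tuples_below)
  also have "\<dots> = (\<Sum>m\<in>{1..<N}. \<Sum>ms\<in>incr_tuples_below (length ks) m. mzv_term ks ms / real m ^ k)"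
    by (intro sum.cong refl mzv_term_snoc length_incr_tuples_below) auto
  also have "\<dots> = mzv_below (rev (ks @ [k])) N"
    by (simp add: snoc sum_divide_distrib)
  finally show ?case ..
qed

text \<open>Fubini, splitting off the largest entry \<open>m\<close> and summing over the finitely
  many smaller tuples. It serves multiple zeta values with \<open>g m = 1\<close> and polylogarithms
  with \<open>g m = z ^ m\<close>.\<close>

lemma infsum_incr_tuples:
  fixes g :: "nat \<Rightarrow> 'a :: {real_normed_field, banach}"
  assumes k: "1 \<le> k" and sm: "summable (\<lambda>m. Li_coeff (k # rev ks) m * norm (g m))"
  shows "infsum (\<lambda>ms. of_real (mzv_term (ks @ [k]) ms) * g (last ms)) (incr_tuples (Suc (length ks)))
           = (\<Sum>m. of_real (Li_coeff (k # rev ks) m) * g m)"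
proof -
  let ?c = "Li_coeff (k # rev ks)"
  let ?T = "incr_tuples_below (length ks)"
  let ?f = "\<lambda>(m, ms). of_real (mzv_term (ks @ [k]) (ms @ [m])) * g m"
  have inner: "(\<Sum>ms\<in>?T m. mzv_term (ks @ [k]) (ms @ [m])) = ?c m" for m
  proof -
    have "(\<Sum>ms\<in>?T m. mzv_term (ks @ [k]) (ms @ [m])) = (\<Sum>ms\<in>?T m. mzv_term ks ms / real m ^ k)"
      by (intro sum.cong refl mzv_term_snoc length_incr_tuples_below)
    thus ?thesis by (simp add: mzv_below_eq_sum sum_divide_distrib)
  qed
  have c0: "?c 0 = 0" using k by (simp add: power_0_left)
  have abs1: "summable (\<lambda>m. norm (of_real (?c m) * g m))"
    using sm by (simp add: norm_mult Li_coeff_nonneg del: Li_coeff.simps)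
  \<comment> \<open>All weights are nonnegative, so the sum of the norms over the pairs collapses to
    the series assumed to converge.\<close>
  have abs: "(\<lambda>p. norm (?f p)) summable_on Sigma {1..} ?T"
  proof (rule Infinite_Sum.abs_summable_on_Sigma_iff[THEN iffD2], intro conjI ballI)
    fix m :: nat assume "m \<in> {1..}"
    show "(\<lambda>ms. norm (?f (m, ms))) summable_on ?T m"
      using finite_incr_tuples_below by simp
  next
    have "infsum (\<lambda>ms. norm (?f (m, ms))) (?T m) = ?c m * norm (g m)" for m
      using finite_incr_tuples_below
      by (simp add: norm_mult mzv_term_nonneg sum_distrib_right[symmetric] inner del: Li_coeff.simps)
    moreover have "(\<lambda>m. ?c m * norm (g m)) summable_on UNIV"
      using sm by (subst summable_on_UNIV_nonneg_real_iff) (auto simp: Li_coeff_nonneg simp del: Li_coeff.simps)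
    hence "(\<lambda>m. ?c m * norm (g m)) summable_on {1..}"
      by (rule summable_on_subset_banach) simp
    ultimately show "(\<lambda>m. norm (infsum (\<lambda>ms. norm (?f (m, ms))) (?T m))) summable_on {1..}"
      by (simp add: abs_mult Li_coeff_nonneg del: Li_coeff.simps)
  qed
  have "infsum (\<lambda>ms. of_real (mzv_term (ks @ [k]) ms) * g (last ms)) (incr_tuples (Suc (length ks)))
       = infsum ?f (Sigma {1..} ?T)"
    unfolding incr_tuples_Suc
    by (subst infsum_reindex[OF inj_snoc]) (auto simp: o_def case_prod_unfold intro!: infsum_cong)
  also have "\<dots> = infsum (\<lambda>m. infsum (\<lambda>ms. ?f (m, ms)) (?T m)) {1..}"
    by (rule infsum_Sigma_banach[symmetric]) (rule Infinite_Sum.abs_summable_summable[OF abs])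
  also have "\<dots> = infsum (\<lambda>m. of_real (?c m) * g m) {1..}"
    using finite_incr_tuples_below
    by (intro infsum_cong) (simp add: sum_distrib_right[symmetric] inner del: Li_coeff.simps flip: of_real_sum)
  \<comment> \<open>The added index \<open>0\<close> contributes nothing, as \<open>?c 0 = 0\<close>
    for \<open>k \<ge> 1\<close>.\<close>
  also have "\<dots> = infsum (\<lambda>m. of_real (?c m) * g m) UNIV"
    using c0 by (intro infsum_cong_neutral) (auto simp: not_le)
  also have "\<dots> = (\<Sum>m. of_real (?c m) * g m)"
    by (intro infsumI norm_summable_imp_has_sum[OF abs1] summable_sums summable_norm_cancel[OF abs1])
  finally show ?thesis .
qed

lemma Li_disk_eq_Li_rev:
  assumes "\<forall>k\<in>set ks. 1 \<le> k" "norm z < 1"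
  shows "Li_disk ks z = Li_rev (rev ks) z"
proof (cases ks rule: rev_cases)
  case Nil
  thus ?thesis by (simp add: Li_disk_def)
next
  case (snoc ks' k)
  have "summable (\<lambda>m. norm (fps_nth (Li_fps (rev ks)) m * z ^ m))"
    using assms by (intro norm_summable_fps Li_fps_conv) auto
  hence sm: "summable (\<lambda>m. Li_coeff (k # rev ks') m * norm (z ^ m))"
    by (simp add: norm_mult snoc Li_coeff_nonneg norm_power del: Li_coeff.simps)
  have summand: "z ^ last ms / (\<Prod>i<length ks. of_nat (ms ! i) ^ (ks ! i)) = of_real (mzv_term ks ms) * z ^ last ms" for ms
    by (simp add: mzv_term_def prod_dividef)
  have "Li_disk ks z = infsum (\<lambda>ms. of_real (mzv_term ks ms) * z ^ last ms) (incr_tuples (length ks))"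
    unfolding Li_disk_def summand using snoc by simp
  also have "\<dots> = infsum (\<lambda>ms. of_real (mzv_term (ks' @ [k]) ms) * z ^ last ms) (incr_tuples (Suc (length ks')))"
    by (simp add: snoc)
  also have "\<dots> = (\<Sum>m. of_real (Li_coeff (k # rev ks') m) * z ^ m)"
    using assms snoc sm by (intro infsum_incr_tuples) auto
  also have "\<dots> = Li_rev (rev ks) z"
    by (simp add: eval_fps_def snoc)
  finally show ?thesis .
qed

lemma mzv_eq_suminf:
  assumes "\<forall>k\<in>set ks. 1 \<le> k" "2 \<le> k"
  shows "mzv (ks @ [k]) = (\<Sum>m. Li_coeff (k # rev ks) m)"
proof -
  have "mzv (ks @ [k]) = infsum (\<lambda>ms. of_real (mzv_term (ks @ [k]) ms) * 1) (incr_tuples (Suc (length ks)))"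
    by (simp add: mzv_def mzv_term_def)
  also have "\<dots> = (\<Sum>m. of_real (Li_coeff (k # rev ks) m) * 1)"
  proof (rule infsum_incr_tuples)
    show "summable (\<lambda>m. Li_coeff (k # rev ks) m * norm (1::real))"
      using Li_coeff_summable[of "rev ks" k] assms by (simp del: Li_coeff.simps)
  qed (use assms in auto)
  finally show ?thesis by simp
qed

section \<open>Radial limits on the unit circle\<close>

lemma Li_rev_continuous_on_disk:
  assumes "\<forall>k\<in>set ks. 1 \<le> k" "2 \<le> k"
  shows "continuous_on (cball 0 1) (Li_rev (k # ks))"
proof -
  have "uniform_limit (cball 0 1) (\<lambda>n z. \<Sum>m<n. fps_nth (Li_fps (k # ks)) m * z ^ m)
         (\<lambda>z. \<Sum>m. fps_nth (Li_fps (k # ks)) m * z ^ m) sequentially"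
  proof (rule Weierstrass_m_test)
    show "summable (Li_coeff (k # ks))" by (rule Li_coeff_summable[OF assms])
    fix n and z :: complex assume z: "z \<in> cball 0 1"
    have "norm (fps_nth (Li_fps (k # ks)) n * z ^ n) = Li_coeff (k # ks) n * norm z ^ n"
      by (simp add: norm_mult norm_power Li_coeff_nonneg del: Li_coeff.simps)
    also have "\<dots> \<le> Li_coeff (k # ks) n * 1"
      using z by (intro mult_left_mono Li_coeff_nonneg power_le_one) auto
    finally show "norm (fps_nth (Li_fps (k # ks)) n * z ^ n) \<le> Li_coeff (k # ks) n" by simp
  qed
  hence "continuous_on (cball 0 1) (\<lambda>z. \<Sum>m. fps_nth (Li_fps (k # ks)) m * z ^ m)"
    by (rule uniform_limit_theorem[rotated]) (auto intro!: always_eventually continuous_intros simp del: Li_fps_nth)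
  thus ?thesis by (simp add: eval_fps_def[abs_def])
qed

lemma Li_rev_tendsto_boundary:
  assumes "\<forall>k\<in>set ks. 1 \<le> k" "2 \<le> k" "norm w = 1"
  shows "((\<lambda>r. Li_rev (k # ks) (of_real r * w)) \<longlongrightarrow> Li_rev (k # ks) w) (at_left 1)"
proof -
  have "continuous_on {0..1} (\<lambda>r::real. Li_rev (k # ks) (of_real r * w))"
    using assms
    by (intro continuous_on_compose2[OF Li_rev_continuous_on_disk[OF assms(1,2)]] continuous_intros)
       (auto simp: norm_mult)
  hence "((\<lambda>r. Li_rev (k # ks) (of_real r * w)) \<longlongrightarrow> Li_rev (k # ks) (of_real 1 * w)) (at 1 within {0..1})"
    unfolding continuous_on_def by (rule bspec) auto
  thus ?thesis
    by (simp add: at_within_Icc_at_left)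
qed

text \<open>Admissible series converge absolutely up to the point \<open>1\<close>. Thus the values
  at real \<open>r\<close>, which occur as integration constants, become multiple zeta
  values.\<close>

lemma Li_rev_tendsto_mzv:
  assumes "\<forall>k\<in>set ks. 1 \<le> k" "admissible ks"
  shows "((\<lambda>r. Li_rev (rev ks) (of_real r)) \<longlongrightarrow> of_real (mzv ks)) (at_left 1)"
proof (cases ks rule: rev_cases)
  case Nil
  have "incr_tuples 0 = {[]}" by (auto simp: incr_tuples_def)
  thus ?thesis using Nil by (simp add: mzv_def)
next
  case (snoc ks' k)
  have k: "\<forall>k\<in>set ks'. 1 \<le> k" "2 \<le> k"
    using assms snoc by (auto simp: admissible_def)
  have "Li_rev (rev ks) 1 = (\<Sum>m. of_real (Li_coeff (k # rev ks') m))"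
    by (simp add: eval_fps_def snoc)
  also have "\<dots> = of_real (mzv ks)"
    unfolding snoc mzv_eq_suminf[OF k]
    using Li_coeff_summable[of "rev ks'" k] k
    by (intro suminf_of_real[symmetric]) (auto simp del: Li_coeff.simps)
  finally show ?thesis
    using Li_rev_tendsto_boundary[of "rev ks'" k 1] k snoc by simp
qed

lemma Li_rev_bounded_tendsto:
  fixes w :: complex
  assumes "\<forall>k\<in>set ks. 1 \<le> k" and w: "norm w = 1" "Im w > 0"
  shows "(\<exists>C. \<forall>s\<in>{0..<1}. norm (Li_rev ks (of_real s * w)) \<le> C) \<and>
         (\<exists>l. ((\<lambda>s. Li_rev ks (of_real s * w)) \<longlongrightarrow> l) (at_left 1))"
  using assms(1)
proof (induction ks)
  case (Cons k ks)
  show ?case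
  proof (cases "k = 1")
    case False
    with Cons.prems have k: "2 \<le> k" "\<forall>k\<in>set ks. 1 \<le> k" by auto
    have "compact (Li_rev (k # ks) ` cball 0 1)"
      using k by (intro compact_continuous_image Li_rev_continuous_on_disk) auto
    then obtain C where "\<forall>z\<in>cball 0 1. norm (Li_rev (k # ks) z) \<le> C"
      using compact_imp_bounded bounded_iff by (metis (no_types, lifting) imageI)
    hence "\<forall>s\<in>{0..<1}. norm (Li_rev (k # ks) (of_real s * w)) \<le> C"
      using w by (auto simp: norm_mult)
    thus ?thesis using Li_rev_tendsto_boundary[OF k(2,1) w(1)] by blast
  next
    case True
    have pos: "\<forall>k\<in>set ks. 1 \<le> k" using Cons.prems by simp
    then obtain C where C: "\<forall>s\<in>{0..<1}. norm (Li_rev ks (of_real s * w)) \<le> C"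
      using Cons by auto
    have C0: "0 \<le> C" using C by (metis atLeastLessThan_iff le_less norm_ge_zero order_trans zero_less_one)
    define B where "B = C / Im w"
    have B0: "0 \<le> B" using C0 w by (simp add: B_def)
    define g where "g = (\<lambda>s::real. Li_rev (1 # ks) (of_real s * w))"
    define S where "S = (\<lambda>s::real. of_real s * w) ` {0..<1}"
    have S: "convex S" unfolding S_def
      by (intro convex_linear_image) (auto intro!: linearI simp: algebra_simps scaleR_conv_of_real)
    have der: "norm (eval_fps (fps_deriv (Li_fps (1 # ks))) (of_real s * w)) \<le> B" if s: "s \<in> {0..<1}" for s
    proof -
      have z: "norm (of_real s * w) < 1" using s w by (simp add: norm_mult)
      have "Im w \<le> norm (1 - of_real s * w)"
      proof -
        \<comment> \<open>Rotation by \<open>cnj w\<close> moves the ray to the real axis, so the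
          imaginary part no longer depends on \<open>s\<close>.\<close>
        have "Im w = Im (cnj w * (- (1 - of_real s * w)))" 
          by (simp add: algebra_simps)
        also have "\<dots> \<le> norm (cnj w * (- (1 - of_real s * w)))"
          using abs_Im_le_cmod abs_le_D1 by blast
        also have "\<dots> = norm (1 - of_real s * w)"
          using w by (simp add: norm_mult norm_minus_commute)
        finally show ?thesis .
      qed
      hence "Im w * norm (eval_fps (fps_deriv (Li_fps (1 # ks))) (of_real s * w)) \<le>
         norm (1 - of_real s * w) * norm (eval_fps (fps_deriv (Li_fps (1 # ks))) (of_real s * w))"
        by (intro mult_right_mono) auto
      also have "\<dots> = norm (Li_rev ks (of_real s * w))"
        using Li_rev_deriv_1[OF pos z] by (metis norm_mult)
      also have "\<dots> \<le> C" using C s by blast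
      finally show ?thesis using w by (simp add: B_def field_simps)
    qed
    have lip: "norm (g s - g t) \<le> B * \<bar>s - t\<bar>" if st: "s \<in> {0..<1}" "t \<in> {0..<1}" for s t
    proof -
      have "norm (Li_rev (1 # ks) (of_real s * w) - Li_rev (1 # ks) (of_real t * w)) \<le> B * norm (of_real s * w - of_real t * w)"
      proof (rule field_differentiable_bound[OF S])
        fix z assume "z \<in> S"
        then obtain u where u: "u \<in> {0..<1}" "z = of_real u * w" by (auto simp: S_def)
        show "(Li_rev (1 # ks) has_field_derivative eval_fps (fps_deriv (Li_fps (1 # ks))) z) (at z within S)"
          using pos u w by (intro Li_rev_deriv) (auto simp: norm_mult)
        show "norm (eval_fps (fps_deriv (Li_fps (1 # ks))) z) \<le> B" using der u by simp
      qed (use st in \<open>auto simp: S_def\<close>)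
      thus ?thesis using w
        by (simp add: g_def norm_mult flip: left_diff_distrib of_real_diff)
    qed
    hence "B-lipschitz_on {0..<1} g"
      using B0 by (auto simp: lipschitz_on_def dist_norm)
    \<comment> \<open>The Lipschitz extension to the closed interval supplies the limit, namely
      \<open>h 1\<close>.\<close>
    then obtain h where h: "B-lipschitz_on (closure {0..<1}) h" "\<forall>x\<in>{0..<1}. h x = g x"
      using lipschitz_extend_closure by blast
    have "continuous_on {0..1} h"
      using h(1) by (simp add: lipschitz_on_continuous_on)
    hence "(h \<longlongrightarrow> h 1) (at 1 within {0..1})"
      by (auto simp: continuous_on_def)
    hence "(h \<longlongrightarrow> h 1) (at_left 1)"
      by (simp add: at_within_Icc_at_left)
    moreover have "\<forall>\<^sub>F s in at_left 1. h s = g s"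
      using eventually_at_left_real[OF zero_less_one] by eventually_elim (use h(2) in auto)
    ultimately have lim: "(g \<longlongrightarrow> h 1) (at_left 1)"
      by (rule Lim_transform_eventually)
    \<comment> \<open>The constant coefficient vanishes, so the Lipschitz estimate against
      \<open>0\<close> also bounds \<open>g\<close>.\<close>
    have g0: "g 0 = 0" by (simp add: g_def eval_fps_at_0)
    have "norm (g s) \<le> B" if "s \<in> {0..<1}" for s
    proof -
      have "norm (g s) \<le> B * \<bar>s\<bar>" using lip[of s 0] g0 that by simp
      also have "\<dots> \<le> B * 1" using B0 that by (intro mult_left_mono) auto
      finally show ?thesis by simp
    qed
    thus ?thesis using lim True unfolding g_def by blast
  qed
qed auto

text \<open>\<open>Li_circ\<close> is defined by \<open>Lim\<close>, which is meaningful only once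
  the limit is known to exist; \<open>sin \<sigma> > 0\<close> places \<open>cis \<sigma>\<close> in
  the upper half plane, where existence was shown.\<close>

lemma Li_rev_tendsto_Li_circ:
  assumes "\<forall>k\<in>set ks. 1 \<le> k" "sin \<sigma> > 0"
  shows "((\<lambda>r. Li_rev (rev ks) (of_real r * cis \<sigma>)) \<longlongrightarrow> Li_circ ks \<sigma>) (at_left 1)"
proof -
  obtain l where l: "((\<lambda>s. Li_rev (rev ks) (of_real s * cis \<sigma>)) \<longlongrightarrow> l) (at_left 1)"
    using Li_rev_bounded_tendsto[of "rev ks" "cis \<sigma>"] assms by auto
  have "\<forall>\<^sub>F r in at_left 1. Li_rev (rev ks) (of_real r * cis \<sigma>) = Li_disk ks (of_real r * cis \<sigma>)"
    using eventually_at_left_real[OF zero_less_one]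
    by eventually_elim (use assms in \<open>auto simp: Li_disk_eq_Li_rev norm_mult\<close>)
  with l have "((\<lambda>r. Li_disk ks (of_real r * cis \<sigma>)) \<longlongrightarrow> l) (at_left 1)"
    by (rule Lim_transform_eventually)
  hence "Li_circ ks \<sigma> = l"
    unfolding Li_circ_def by (intro tendsto_Lim) auto
  with l show ?thesis by simp
qed

section \<open>Rational spans\<close>

lemma qspan_base: "x \<in> S \<Longrightarrow> x \<in> qspan S"
  unfolding qspan_def by (auto intro!: exI[of _ "{x}"] exI[of _ "\<lambda>_. 1"])

lemma qspan_0: "0 \<in> qspan S"
  unfolding qspan_def by (auto intro!: exI[of _ "{}"])

lemma qspan_add:
  assumes "x \<in> qspan S" "y \<in> qspan S"
  shows "x + y \<in> qspan S"
proof -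
  obtain F c where F: "finite F" "F \<subseteq> S" "\<forall>s\<in>F. c s \<in> \<rat>" "x = (\<Sum>s\<in>F. c s * s)"
    using assms(1) by (auto simp: qspan_def)
  obtain G e where G: "finite G" "G \<subseteq> S" "\<forall>s\<in>G. e s \<in> \<rat>" "y = (\<Sum>s\<in>G. e s * s)"
    using assms(2) by (auto simp: qspan_def)
  define h where "h s = (if s \<in> F then c s else 0) + (if s \<in> G then e s else 0)" for s
  have "x = (\<Sum>s\<in>F \<union> G. (if s \<in> F then c s else 0) * s)"
    unfolding F(4) using F(1) G(1) by (intro sum.mono_neutral_cong_left) auto
  moreover have "y = (\<Sum>s\<in>F \<union> G. (if s \<in> G then e s else 0) * s)"
    unfolding G(4) using F(1) G(1) by (intro sum.mono_neutral_cong_left) auto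
  ultimately have "x + y = (\<Sum>s\<in>F \<union> G. h s * s)"
    by (simp add: h_def distrib_right sum.distrib)
  moreover have "\<forall>s\<in>F \<union> G. h s \<in> \<rat>" using F G by (auto simp: h_def)
  ultimately show ?thesis unfolding qspan_def using F G
    by (auto intro!: exI[of _ "F \<union> G"] exI[of _ h])
qed

lemma qspan_scale:
  assumes "x \<in> qspan S" "q \<in> \<rat>"
  shows "q * x \<in> qspan S"
proof -
  obtain F c where F: "finite F" "F \<subseteq> S" "\<forall>s\<in>F. c s \<in> \<rat>" "x = (\<Sum>s\<in>F. c s * s)"
    using assms(1) by (auto simp: qspan_def)
  thus ?thesis unfolding qspan_def using assms(2)
    by (auto intro!: exI[of _ F] exI[of _ "\<lambda>s. q * c s"] simp: sum_distrib_left mult.assoc)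
qed

lemma qspan_neg: "x \<in> qspan S \<Longrightarrow> - x \<in> qspan S"
  using qspan_scale[of x S "-1"] by simp

lemma qspan_diff: "x \<in> qspan S \<Longrightarrow> y \<in> qspan S \<Longrightarrow> x - y \<in> qspan S"
  using qspan_add[of x S "-y"] qspan_neg[of y S] by simp

lemma qspan_sum: "(\<And>i. i \<in> I \<Longrightarrow> f i \<in> qspan S) \<Longrightarrow> (\<Sum>i\<in>I. f i) \<in> qspan S"
  by (induction I rule: infinite_finite_induct) (auto intro: qspan_0 qspan_add)

lemma qspan_sum_list: "(\<And>i. i \<in> set xs \<Longrightarrow> f i \<in> qspan S) \<Longrightarrow> (\<Sum>i\<leftarrow>xs. f i) \<in> qspan S"
  by (induction xs) (auto intro: qspan_0 qspan_add)

lemma qspan_mono: "S \<subseteq> T \<Longrightarrow> qspan S \<subseteq> qspan T"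
  unfolding qspan_def by blast

text \<open>Bilinear expansion reduces the claim to products of generators.\<close>

lemma qspan_mult:
  assumes "x \<in> qspan S" "y \<in> qspan T" "\<And>s t. s \<in> S \<Longrightarrow> t \<in> T \<Longrightarrow> s * t \<in> qspan U"
  shows "x * y \<in> qspan U"
proof -
  obtain F c where F: "finite F" "F \<subseteq> S" "\<forall>s\<in>F. c s \<in> \<rat>" "x = (\<Sum>s\<in>F. c s * s)"
    using assms(1) by (auto simp: qspan_def)
  obtain G e where G: "finite G" "G \<subseteq> T" "\<forall>s\<in>G. e s \<in> \<rat>" "y = (\<Sum>s\<in>G. e s * s)"
    using assms(2) by (auto simp: qspan_def)
  have "x * y = (\<Sum>s\<in>F. \<Sum>t\<in>G. (c s * e t) * (s * t))"
    unfolding F(4) G(4) sum_product by (simp add: mult_ac)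
  also have "\<dots> \<in> qspan U"
  proof (intro qspan_sum)
    fix s t assume "s \<in> F" "t \<in> G"
    thus "(c s * e t) * (s * t) \<in> qspan U"
      by (intro qspan_scale[of "s * t"] assms(3)) (use F G in auto)
  qed
  finally show ?thesis .
qed

section \<open>Iterated integrals and the shuffle product\<close>

text \<open>A class of integrands with a singularity at \<open>0\<close>: the majorant
  \<open>t powr (-1/2)\<close> is integrable, dominates every power of the logarithm near
  \<open>0\<close>, and survives multiplication by functions continuous on the closed
  interval.\<close>

definition sqrt_dominated :: "real \<Rightarrow> (real \<Rightarrow> real) \<Rightarrow> bool" where
  "sqrt_dominated c f \<longleftrightarrow> continuous_on {0<..c} f \<and> (\<exists>K. \<forall>t\<in>{0<..c}. \<bar>f t\<bar> \<le> K * t powr (-1/2))"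

lemma sqrt_dominated_mult:
  assumes "sqrt_dominated c f" "continuous_on {0..c} h"
  shows "sqrt_dominated c (\<lambda>t. f t * h t)"
proof -
  obtain K where K: "\<forall>t\<in>{0<..c}. \<bar>f t\<bar> \<le> K * t powr (-1/2)"
    using assms(1) by (auto simp: sqrt_dominated_def)
  have "compact (h ` {0..c})" using assms(2) by (intro compact_continuous_image) auto
  then obtain M where M: "\<forall>t\<in>{0..c}. \<bar>h t\<bar> \<le> M"
    by (metis bounded_iff compact_imp_bounded imageI real_norm_def)
  have "\<bar>f t * h t\<bar> \<le> (K * M) * t powr (-1/2)" if t: "t \<in> {0<..c}" for t
  proof -
    have "\<bar>f t\<bar> * \<bar>h t\<bar> \<le> (K * t powr (-1/2)) * M"
    proof (rule mult_mono)
      show "\<bar>f t\<bar> \<le> K * t powr (-1/2)" using K t by blast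
      thus "0 \<le> K * t powr (-1/2)" by linarith
    qed (use M t in auto)
    thus ?thesis by (simp add: abs_mult mult_ac)
  qed
  moreover have "continuous_on {0<..c} h"
    using assms(2) by (rule continuous_on_subset) auto
  ultimately show ?thesis using assms(1)
    by (auto simp: sqrt_dominated_def intro!: continuous_intros exI[of _ "K * M"])
qed

lemma sqrt_dominated_integrable:
  assumes "sqrt_dominated c f" "0 \<le> c"
  shows "f integrable_on {0..c}"
proof -
  obtain K where K: "\<forall>t\<in>{0<..c}. \<bar>f t\<bar> \<le> K * t powr (-1/2)"
    using assms(1) by (auto simp: sqrt_dominated_def)
  have "f integrable_on {0<..c}"
  proof (rule measurable_bounded_by_integrable_imp_integrable)
    show "f \<in> borel_measurable (lebesgue_on {0<..c})"
      using assms(1) by (intro continuous_imp_measurable_on_sets_lebesgue) (auto simp: sqrt_dominated_def)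
    show "(\<lambda>t. K * t powr (-1/2)) integrable_on {0<..c}"
      using integrable_on_powr_from_0'[of "-1/2" c] assms(2)
      by (intro integrable_on_mult_right) auto
  qed (use K in auto)
  moreover have "{0<..c} - {0..c} = {}" "{0..c} - {0<..c} = {0}"
    using assms(2) by auto
  ultimately show ?thesis
    by (subst integrable_spike_set_eq[of _ "{0<..c}"]) (auto simp: sup_commute)
qed

lemma iter_int_rev_continuous:
  assumes "\<forall>f\<in>set fs. sqrt_dominated c f" "0 \<le> c"
  shows "continuous_on {0..c} (iter_int_rev fs)"
  using assms(1)
proof (induction fs)
  case (Cons f fs)
  have "(\<lambda>t. f t * iter_int_rev fs t) integrable_on {0..c}"
    using Cons assms(2) by (intro sqrt_dominated_integrable sqrt_dominated_mult) auto
  from indefinite_integral_continuous_1[OF this] show ?case by simp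
qed simp

text \<open>The fundamental theorem of calculus, at interior points only, since \<open>f\<close> may
  be unbounded at \<open>0\<close>.\<close>

lemma iter_int_rev_deriv:
  assumes "\<forall>f\<in>set (f # fs). sqrt_dominated c f" "x \<in> {0<..<c}"
  shows "(iter_int_rev (f # fs) has_real_derivative f x * iter_int_rev fs x) (at x)"
proof -
  have c: "0 \<le> c" using assms(2) by auto
  have g: "sqrt_dominated c (\<lambda>t. f t * iter_int_rev fs t)"
    using assms c by (intro sqrt_dominated_mult iter_int_rev_continuous) auto
  have "continuous_on {0<..<c} (\<lambda>t. f t * iter_int_rev fs t)"
    using g by (auto simp: sqrt_dominated_def intro: continuous_on_subset)
  hence "isCont (\<lambda>t. f t * iter_int_rev fs t) x"
    using assms(2) by (simp add: continuous_on_eq_continuous_at)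
  hence "((\<lambda>u. integral {0..u} (\<lambda>t. f t * iter_int_rev fs t)) has_vector_derivative
          f x * iter_int_rev fs x) (at x within ({0..c} - {}))"
    using g c assms(2)
    by (intro integral_has_vector_derivative_continuous_at sqrt_dominated_integrable)
       (auto intro: continuous_at_imp_continuous_at_within)
  moreover have "at x within ({0..c} - {}) = at x"
    using assms(2) by (auto intro!: at_within_interior)
  ultimately show ?thesis
    by (simp add: has_real_derivative_iff_has_vector_derivative iter_int_rev.simps(2)[abs_def])
qed

section \<open>Shuffles and products of iterated integrals\<close>

fun shuffle_list :: "'a list \<Rightarrow> 'a list \<Rightarrow> 'a list list" where
  "shuffle_list [] ys = [ys]"
| "shuffle_list (x # xs) [] = [x # xs]"
| "shuffle_list (x # xs) (y # ys) =
     map ((#) x) (shuffle_list xs (y # ys)) @ map ((#) y) (shuffle_list (x # xs) ys)"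

lemma mset_shuffle_list: "zs \<in> set (shuffle_list xs ys) \<Longrightarrow> mset zs = mset xs + mset ys"
  by (induction xs ys arbitrary: zs rule: shuffle_list.induct) auto

lemma set_shuffle_list: "zs \<in> set (shuffle_list xs ys) \<Longrightarrow> set zs = set xs \<union> set ys"
  using mset_shuffle_list[of zs xs ys] by (metis set_mset_mset set_mset_union)

lemma integral_sum_list:
  assumes "\<And>x. x \<in> set xs \<Longrightarrow> f x integrable_on S"
  shows "(\<lambda>t. \<Sum>x\<leftarrow>xs. f x t) integrable_on S \<and>
         integral S (\<lambda>t. \<Sum>x\<leftarrow>xs. f x t :: real) = (\<Sum>x\<leftarrow>xs. integral S (f x))"
  using assms by (induction xs) (auto simp: integral_add integrable_add integrable_0)

text \<open>The product rule separates the terms by their outermost integrand, and integrating the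
  induction hypothesis gives the two halves of the shuffle. The lists contain labels and
  \<open>\<phi>\<close> supplies the integrands, so that weights can be counted on labels.\<close>

lemma iter_int_rev_shuffle:
  assumes "\<forall>x\<in>set xs \<union> set ys. sqrt_dominated c (\<phi> x)" "\<sigma> \<in> {0..c}"
  shows "iter_int_rev (map \<phi> xs) \<sigma> * iter_int_rev (map \<phi> ys) \<sigma> =
         (\<Sum>zs\<leftarrow>shuffle_list xs ys. iter_int_rev (map \<phi> zs) \<sigma>)"
  using assms
proof (induction xs ys arbitrary: \<sigma> rule: shuffle_list.induct)
  case (3 x xs y ys)
  let ?I = "\<lambda>zs. iter_int_rev (map \<phi> zs)"
  have c: "0 \<le> c" "0 \<le> \<sigma>" "\<sigma> \<le> c" using "3.prems" by auto
  have good: "\<forall>f\<in>set (map \<phi> zs). sqrt_dominated c f" if "set zs \<subseteq> set (x # xs) \<union> set (y # ys)" for zs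
    using that "3.prems"(1) by auto
  have cont: "continuous_on {0..\<sigma>} (?I zs)" if "set zs \<subseteq> set (x # xs) \<union> set (y # ys)" for zs
    using iter_int_rev_continuous[OF good[OF that] c(1)] c by (auto intro: continuous_on_subset)
  have int: "(\<lambda>t. \<phi> z t * ?I zs t) integrable_on {0..\<sigma>}"
    if "set (z # zs) \<subseteq> set (x # xs) \<union> set (y # ys)" for z zs
  proof -
    have "(\<lambda>t. \<phi> z t * ?I zs t) integrable_on {0..c}"
      using that good[of "z # zs"] c
      by (intro sqrt_dominated_integrable sqrt_dominated_mult iter_int_rev_continuous) auto
    thus ?thesis by (rule integrable_on_subinterval) (use c in auto)
  qed
  let ?A = "shuffle_list xs (y # ys)" and ?B = "shuffle_list (x # xs) ys"
  have A: "set (x # zs) \<subseteq> set (x # xs) \<union> set (y # ys)" if "zs \<in> set ?A" for zs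
    using set_shuffle_list[OF that] by auto
  have B: "set (y # zs) \<subseteq> set (x # xs) \<union> set (y # ys)" if "zs \<in> set ?B" for zs
    using set_shuffle_list[OF that] by auto
  let ?p = "\<lambda>t. \<phi> x t * ?I xs t * ?I (y # ys) t + ?I (x # xs) t * (\<phi> y t * ?I ys t)"
  \<comment> \<open>Continuity up to the endpoints and differentiability inside suffice here; the
    value at \<open>0\<close> is an integral over a point and vanishes.\<close>
  have "(?p has_integral ?I (x # xs) \<sigma> * ?I (y # ys) \<sigma> - ?I (x # xs) 0 * ?I (y # ys) 0) {0..\<sigma>}"
  proof (rule fundamental_theorem_of_calculus_interior)
    show "continuous_on {0..\<sigma>} (\<lambda>\<sigma>. ?I (x # xs) \<sigma> * ?I (y # ys) \<sigma>)"
      by (intro continuous_on_mult cont) auto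
    fix t assume t: "t \<in> {0<..<\<sigma>}"
    have "(?I (x # xs) has_real_derivative \<phi> x t * ?I xs t) (at t)"
      unfolding list.map using t c good[of "x # xs"] by (intro iter_int_rev_deriv) auto
    moreover have "(?I (y # ys) has_real_derivative \<phi> y t * ?I ys t) (at t)"
      unfolding list.map using t c good[of "y # ys"] by (intro iter_int_rev_deriv) auto
    ultimately have "((\<lambda>\<sigma>. ?I (x # xs) \<sigma> * ?I (y # ys) \<sigma>) has_real_derivative
         \<phi> x t * ?I xs t * ?I (y # ys) t + (\<phi> y t * ?I ys t) * ?I (x # xs) t) (at t)"
      by (rule DERIV_mult)
    thus "((\<lambda>\<sigma>. ?I (x # xs) \<sigma> * ?I (y # ys) \<sigma>) has_vector_derivative ?p t) (at t)"
      by (simp add: has_real_derivative_iff_has_vector_derivative mult_ac)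
  qed (use c in auto)
  hence "?I (x # xs) \<sigma> * ?I (y # ys) \<sigma> = integral {0..\<sigma>} ?p"
    by (simp add: integral_unique)
  also have "\<dots> = integral {0..\<sigma>} (\<lambda>t. (\<Sum>zs\<leftarrow>?A. \<phi> x t * ?I zs t) + (\<Sum>zs\<leftarrow>?B. \<phi> y t * ?I zs t))"
  proof (rule integral_cong)
    fix t assume "t \<in> {0..\<sigma>}"
    hence t: "t \<in> {0..c}" using c by auto
    have "?I xs t * ?I (y # ys) t = (\<Sum>zs\<leftarrow>?A. ?I zs t)"
      using "3.IH"(1)[of t] "3.prems"(1) t by auto
    moreover have "?I (x # xs) t * ?I ys t = (\<Sum>zs\<leftarrow>?B. ?I zs t)"
      using "3.IH"(2)[of t] "3.prems"(1) t by auto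
    moreover have "?p t = \<phi> x t * (?I xs t * ?I (y # ys) t) + \<phi> y t * (?I (x # xs) t * ?I ys t)"
      by (simp only: mult_ac)
    ultimately show "?p t = (\<Sum>zs\<leftarrow>?A. \<phi> x t * ?I zs t) + (\<Sum>zs\<leftarrow>?B. \<phi> y t * ?I zs t)"
      by (simp only: sum_list_const_mult)
  qed
  also have "\<dots> = integral {0..\<sigma>} (\<lambda>t. \<Sum>zs\<leftarrow>?A. \<phi> x t * ?I zs t) + integral {0..\<sigma>} (\<lambda>t. \<Sum>zs\<leftarrow>?B. \<phi> y t * ?I zs t)"
    using int[OF A] int[OF B] by (intro integral_add integral_sum_list[THEN conjunct1]) auto
  also have "integral {0..\<sigma>} (\<lambda>t. \<Sum>zs\<leftarrow>?A. \<phi> x t * ?I zs t) = (\<Sum>zs\<leftarrow>?A. ?I (x # zs) \<sigma>)"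
    using int[OF A] by (subst integral_sum_list[THEN conjunct2]) auto
  also have "integral {0..\<sigma>} (\<lambda>t. \<Sum>zs\<leftarrow>?B. \<phi> y t * ?I zs t) = (\<Sum>zs\<leftarrow>?B. ?I (y # zs) \<sigma>)"
    using int[OF B] by (subst integral_sum_list[THEN conjunct2]) auto
  finally show ?case by (simp add: o_def)
qed auto

section \<open>The logarithmic sine on and inside the unit circle\<close>

text \<open>A logarithm is bounded by any small positive power. The base \<open>2 / t\<close> is at
  least \<open>1\<close> on the whole interval, which contains all angles up to
  \<open>pi/3\<close>.\<close>

lemma ln_power_le_powr:
  fixes a :: real
  assumes "0 \<le> a"
  shows "\<exists>K. \<forall>t\<in>{0<..2}. (a + \<bar>ln t\<bar>) ^ m \<le> K * t powr (-1/2)"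
proof (intro exI ballI)
  \<comment> \<open>Chosen so that the \<open>m\<close>-th power of \<open>(2 / t) powr e\<close>
    has exponent at most \<open>1/2\<close>, also for \<open>m = 0\<close>.\<close>
  define e where "e = 1 / (2 * (real m + 1))"
  have e: "0 < e" "e * real m \<le> 1/2" by (auto simp: e_def field_simps)
  define C where "C = a + 1 + 1 / e"
  have C: "0 \<le> C" using assms e by (simp add: C_def)
  fix t :: real assume t: "t \<in> {0<..2}"
  hence u: "1 \<le> 2 / t" by (simp add: field_simps)
  have "ln t \<le> ln 2" using t by (subst ln_le_cancel_iff) auto
  moreover have "ln (2 / t) = ln 2 - ln t" using t by (simp add: ln_div)
  moreover have "0 \<le> ln (2::real)" "ln (2::real) \<le> 1"
    using ln_2_less_1 by auto
  moreover have "\<bar>L\<bar> \<le> 1 + N" if "L \<le> M" "N = M - L" "0 \<le> M" "M \<le> 1" for L M N :: real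
    using that by linarith
  ultimately have "\<bar>ln t\<bar> \<le> 1 + ln (2 / t)" by blast
  hence "a + \<bar>ln t\<bar> \<le> (a + 1) * 1 + ln (2 / t)" by simp
  also have "\<dots> \<le> (a + 1) * (2 / t) powr e + (2 / t) powr e / e"
    using u e assms by (intro add_mono mult_left_mono ln_powr_bound ge_one_powr_ge_zero) auto
  also have "\<dots> = C * (2 / t) powr e" by (simp add: C_def algebra_simps)
  finally have "(a + \<bar>ln t\<bar>) ^ m \<le> (C * (2 / t) powr e) ^ m"
    using assms by (intro power_mono) auto
  also have "\<dots> = C ^ m * (2 / t) powr (e * real m)"
    using u t by (simp add: power_mult_distrib powr_powr[symmetric] powr_realpow)
  also have "\<dots> \<le> C ^ m * (2 / t) powr (1/2)"
    using u e C by (intro mult_left_mono powr_mono) auto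
  also have "(2 / t) powr (1/2) = 2 powr (1/2) * t powr (-1/2)"
    using t by (simp add: powr_divide powr_minus field_simps)
  finally show "(a + \<bar>ln t\<bar>) ^ m \<le> (C ^ m * 2 powr (1/2)) * t powr (-1/2)"
    by simp
qed

text \<open>The deformation of \<open>A_fun\<close> to radius \<open>r\<close>: the subtracted term
  is the imaginary part of the logarithm at \<open>r = 1\<close>, while for \<open>r < 1\<close> the
  logarithm is \<open>- Li_1\<close>.\<close>

definition A_disk :: "real \<Rightarrow> real \<Rightarrow> complex" where
  "A_disk r t = Ln (1 - of_real r * cis t) - (\<i> * of_real t - \<i> * of_real pi) / 2"

text \<open>By the mean value theorem, because \<open>cos\<close> is at least \<open>1/2\<close> up
  to \<open>pi/3\<close>.\<close>

lemma sin_ge_half: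
  assumes "t \<in> {0..pi/3}"
  shows "t / 2 \<le> sin t"
proof (cases "t = 0")
  case False
  then obtain z where z: "0 < z" "z < t" "sin t - sin 0 = (t - 0) * cos z"
    using MVT2[of 0 t sin cos] assms by auto
  have "cos (pi/3) \<le> cos z" using z assms by (intro cos_monotone_0_pi_le) auto
  hence "1 / 2 \<le> cos z" by (simp add: cos_60)
  hence "t * (1/2) \<le> t * cos z" using assms by (intro mult_left_mono) auto
  thus ?thesis using z by simp
qed auto

text \<open>The bound is uniform in \<open>r\<close> and thus a majorant for dominated convergence.
  The modulus of \<open>1 - of_real r * cis t\<close> lies between \<open>t / 4\<close>, by its
  imaginary part, and \<open>2\<close>.\<close>

lemma norm_A_disk_le:
  assumes r: "1/2 \<le> r" "r \<le> 1" and t: "t \<in> {0<..pi/3}"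
  shows "norm (A_disk r t) \<le> 10 + \<bar>ln t\<bar>"
proof -
  let ?z = "1 - of_real r * cis t"
  have "t / 2 \<le> sin t" using t by (intro sin_ge_half) auto
  hence "1/2 * (t / 2) \<le> r * sin t" using r t by (intro mult_mono) auto
  also have "r * sin t = \<bar>Im ?z\<bar>" using r t \<open>t / 2 \<le> sin t\<close> by (simp add: abs_mult)
  also have "\<dots> \<le> norm ?z" by (rule abs_Im_le_cmod)
  finally have lo: "t / 4 \<le> norm ?z" by simp
  have "norm ?z \<le> norm (1::complex) + norm (of_real r * cis t)" by (rule norm_triangle_ineq4)
  also have "\<dots> \<le> 2" using r by (simp add: norm_mult)
  finally have hi: "norm ?z \<le> 2" .
  have z0: "?z \<noteq> 0" using lo t by auto
  have l2: "ln (2::real) \<le> 1" using ln_2_less_1 by simp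
  have l4: "ln (4::real) = 2 * ln 2" using ln_realpow[of 2 2] by simp
  have "ln (t / 4) \<le> ln (norm ?z)" using lo t by (subst ln_le_cancel_iff) auto
  moreover have "ln (t / 4) = ln t - ln 4" using t by (simp add: ln_div)
  moreover have "ln (norm ?z) \<le> ln 2" using hi z0 by (subst ln_le_cancel_iff) auto
  ultimately have A: "\<bar>ln (norm ?z)\<bar> \<le> 2 + \<bar>ln t\<bar>" using l2 l4 by linarith
  have "norm (Ln ?z) \<le> \<bar>Re (Ln ?z)\<bar> + \<bar>Im (Ln ?z)\<bar>" by (rule cmod_le)
  also have "\<dots> \<le> (2 + \<bar>ln t\<bar>) + pi"
    using A z0 Im_Ln_le_pi[OF z0] mpi_less_Im_Ln[OF z0] by (intro add_mono) auto
  finally have B: "norm (Ln ?z) \<le> 2 + \<bar>ln t\<bar> + pi" .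
  have "norm ((\<i> * of_real t - \<i> * of_real pi) / 2) = \<bar>t - pi\<bar> / 2"
    by (simp add: norm_mult norm_divide flip: right_diff_distrib of_real_diff)
  also have "\<dots> \<le> pi / 2" using t by auto
  finally have "norm (A_disk r t) \<le> 2 + \<bar>ln t\<bar> + pi + pi / 2"
    unfolding A_disk_def using B norm_triangle_ineq4[of "Ln ?z" "(\<i> * of_real t - \<i> * of_real pi) / 2"] by linarith
  \<comment> \<open>The constants amount to less than \<open>2 + 4 + 2\<close>; the value
    \<open>10\<close> leaves room.\<close>
  thus ?thesis using pi_less_4 by linarith
qed

text \<open>\<open>1 - cis t = 2 * sin (t / 2) * cis ((t - pi) / 2)\<close>, and the angle
  \<open>(t - pi) / 2\<close> lies in the range of the principal logarithm.\<close>

lemma A_disk_1: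
  assumes t: "t \<in> {0<..pi/3}"
  shows "A_disk 1 t = of_real (A_fun t)"
proof -
  have s: "0 < sin (t / 2)" using t by (intro sin_gt_zero) auto
  let ?w = "of_real (A_fun t) + \<i> * of_real ((t - pi) / 2)"
  have "exp ?w = of_real (2 * sin (t / 2)) * cis ((t - pi) / 2)"
  proof -
    have "exp (A_fun t) = 2 * sin (t / 2)" using s by (simp add: A_fun_def)
    thus ?thesis by (metis cis_conv_exp exp_add exp_of_real)
  qed
  also have "\<dots> = 1 - cis t"
  proof -
    have a: "(t - pi) / 2 = t / 2 - pi / 2" by (simp add: field_simps)
    have c: "cos t = 1 - 2 * sin (t / 2) ^ 2" using cos_double_sin[of "t / 2"] by simp
    have d: "sin t = 2 * sin (t / 2) * cos (t / 2)" using sin_double[of "t / 2"] by simp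
    show ?thesis unfolding a
      by (rule complex_eqI) (simp_all add: cos_diff sin_diff c d power2_eq_square)
  qed
  finally have "Ln (1 - cis t) = Ln (exp ?w)" by simp
  also have "\<dots> = ?w" using t by (intro Ln_exp) auto
  finally show ?thesis by (simp add: A_disk_def field_simps)
qed

lemma A_disk_tendsto:
  assumes t: "t \<in> {0<..pi/3}"
  shows "((\<lambda>r. A_disk r t) \<longlongrightarrow> of_real (A_fun t)) (at_left 1)"
proof -
  have "0 < sin t" using t by (intro sin_gt_zero) auto
  hence "1 - of_real 1 * cis t \<notin> \<real>\<^sub>\<le>\<^sub>0"
    by (auto simp: complex_nonpos_Reals_iff)
  hence "((\<lambda>r. A_disk r t) \<longlongrightarrow> A_disk 1 t) (at_left 1)"
    unfolding A_disk_def by (intro tendsto_intros)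
  thus ?thesis using A_disk_1[OF t] by simp
qed

lemma A_fun_continuous: "continuous_on {0<..pi/3} A_fun"
proof -
  have "sin (t / 2) \<noteq> 0" if "t \<in> {0<..pi/3}" for t
    using that sin_gt_zero[of "t / 2"] by auto
  thus ?thesis unfolding A_fun_def[abs_def] by (intro continuous_intros) auto
qed

text \<open>The estimate for \<open>A_disk\<close> at \<open>r = 1\<close> is an estimate for
  \<open>A_fun\<close>.\<close>

lemma A_fun_power_dominated: "sqrt_dominated (pi/3) (\<lambda>t. A_fun t ^ m)"
proof -
  obtain K where K: "\<forall>t\<in>{0<..2::real}. (10 + \<bar>ln t\<bar>) ^ m \<le> K * t powr (-1/2)"
    using ln_power_le_powr[of 10 m] by auto
  have "\<bar>A_fun t ^ m\<bar> \<le> K * t powr (-1/2)" if t: "t \<in> {0<..pi/3}" for t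
  proof -
    have "\<bar>A_fun t\<bar> \<le> 10 + \<bar>ln t\<bar>"
      using norm_A_disk_le[of 1 t] A_disk_1[OF t] t by simp
    hence "\<bar>A_fun t\<bar> ^ m \<le> (10 + \<bar>ln t\<bar>) ^ m" by (intro power_mono) auto
    also have "\<dots> \<le> K * t powr (-1/2)" using K t pi_less_4 by auto
    finally show ?thesis by (simp add: power_abs)
  qed
  thus ?thesis unfolding sqrt_dominated_def
    by (intro conjI exI[of _ K] ballI continuous_on_power A_fun_continuous)
qed

section \<open>Spans of the values SLs\<close>

text \<open>Both parities in one family, with \<open>True\<close> for odd, so that the parity of a
  product is \<open>p \<noteq> q\<close>.\<close>

definition S_par :: "bool \<Rightarrow> nat \<Rightarrow> nat \<Rightarrow> real set" where
  "S_par p k d = {pi ^ m * SLs ks | m ks.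
      m + sum_list ks = k \<and> length ks \<le> d \<and> odd (length ks) = p \<and> (\<forall>x\<in>set ks. 2 \<le> x)}"

lemma S_o_eq: "S_o k d = S_par True k d" and S_e_eq: "S_e k d = S_par False k d"
  by (auto simp: S_par_def S_o_def S_e_def)

lemma S_par_mono: "d \<le> d' \<Longrightarrow> S_par p k d \<subseteq> S_par p k d'"
proof
  fix x assume d: "d \<le> d'" and "x \<in> S_par p k d"
  then obtain m ks where "x = pi ^ m * SLs ks" "m + sum_list ks = k" "length ks \<le> d"
    "odd (length ks) = p" "\<forall>x\<in>set ks. 2 \<le> x"
    by (auto simp: S_par_def)
  with d show "x \<in> S_par p k d'"
    unfolding S_par_def by (intro CollectI exI[of _ m] exI[of _ ks]) auto
qed

text \<open>The shuffle acts on the indices as labels, reversed because \<open>iter_int_rev\<close>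
  takes the outermost integrand first.\<close>

lemma SLs_mult:
  "SLs as * SLs bs = (\<Sum>zs\<leftarrow>shuffle_list (rev as) (rev bs). SLs (rev zs))"
proof -
  let ?\<phi> = "\<lambda>k \<theta>. (\<theta> - pi/3) ^ (k - 2) * A_fun \<theta>"
  have "sqrt_dominated (pi/3) (\<lambda>\<theta>. A_fun \<theta> ^ 1 * (\<theta> - pi/3) ^ (k - 2))" for k
    by (intro sqrt_dominated_mult A_fun_power_dominated continuous_intros)
  hence dom: "sqrt_dominated (pi/3) (?\<phi> k)" for k
    by (simp add: mult.commute)
  have "SLs xs = iter_int_rev (map ?\<phi> (rev xs)) (pi/3)" for xs
    by (simp add: SLs_def iter_int_def rev_map)
  thus ?thesis
    using iter_int_rev_shuffle[of "rev as" "rev bs" "pi/3" ?\<phi> "pi/3"] dom by simp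
qed

text \<open>A shuffle keeps the multiset of entries, so weights and depths add, and so do the
  parities of the depths.\<close>

lemma S_par_mult:
  assumes "x \<in> S_par p k d" "y \<in> S_par q k' d'"
  shows "x * y \<in> qspan (S_par (p \<noteq> q) (k + k') (d + d'))"
proof -
  obtain m as where x: "x = pi ^ m * SLs as" "m + sum_list as = k" "length as \<le> d"
    "odd (length as) = p" "\<forall>x\<in>set as. 2 \<le> x"
    using assms(1) by (auto simp: S_par_def)
  obtain n bs where y: "y = pi ^ n * SLs bs" "n + sum_list bs = k'" "length bs \<le> d'"
    "odd (length bs) = q" "\<forall>x\<in>set bs. 2 \<le> x"
    using assms(2) by (auto simp: S_par_def)
  have "x * y = pi ^ (m + n) * (SLs as * SLs bs)"
    by (simp add: x y power_add)
  also have "\<dots> = (\<Sum>zs\<leftarrow>shuffle_list (rev as) (rev bs). pi ^ (m + n) * SLs (rev zs))"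
    by (simp add: SLs_mult sum_list_const_mult)
  also have "\<dots> \<in> qspan (S_par (p \<noteq> q) (k + k') (d + d'))"
  proof (intro qspan_sum_list qspan_base)
    fix zs assume zs: "zs \<in> set (shuffle_list (rev as) (rev bs))"
    have ms: "mset zs = mset as + mset bs" using mset_shuffle_list[OF zs] by simp
    have "sum_list zs = sum_list as + sum_list bs" "length zs = length as + length bs"
      "set zs = set as \<union> set bs"
      using ms by (metis sum_mset_sum_list sum_mset.union, metis size_mset size_union,
                   metis set_mset_mset set_mset_union)
    thus "pi ^ (m + n) * SLs (rev zs) \<in> S_par (p \<noteq> q) (k + k') (d + d')"
      unfolding S_par_def using x y
      by (intro CollectI exI[of _ "m + n"] exI[of _ "rev zs"]) auto
  qed
  finally show ?thesis .
qed

text \<open>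
  The factor \<open>\<i> ^ k\<close> makes these spaces multiplicative while separating the two parities.
\<close>

definition twisted_span :: "nat \<Rightarrow> nat \<Rightarrow> complex set" where
  "twisted_span k d = {x. Re (\<i> ^ k * x) \<in> qspan (S_e k d) \<and> Im (\<i> ^ k * x) \<in> qspan (S_o k d)}"

lemma twisted_span_add: "x \<in> twisted_span k d \<Longrightarrow> y \<in> twisted_span k d \<Longrightarrow> x + y \<in> twisted_span k d"
  unfolding twisted_span_def mem_Collect_eq distrib_left plus_complex.sel by (blast intro: qspan_add)

lemma twisted_span_scale:
  assumes "x \<in> twisted_span k d" "q \<in> \<rat>"
  shows "of_real q * x \<in> twisted_span k d"
proof -
  define y where "y = \<i> ^ k * x"
  have eq: "\<i> ^ k * (of_real q * x) = of_real q * y" by (simp add: y_def)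
  have "Re y \<in> qspan (S_e k d)" "Im y \<in> qspan (S_o k d)"
    using assms(1) by (simp_all only: twisted_span_def mem_Collect_eq y_def)
  thus ?thesis using assms(2) unfolding twisted_span_def mem_Collect_eq eq by (simp add: qspan_scale)
qed

lemma twisted_span_mono:
  assumes "x \<in> twisted_span k d" "d \<le> d'"
  shows "x \<in> twisted_span k d'"
  using assms qspan_mono[OF S_par_mono[OF assms(2)]] unfolding twisted_span_def S_o_eq S_e_eq by blast

text \<open>The parity grading is that of complex multiplication: the real part combines even times
  even and odd times odd, the imaginary part the mixed products.\<close>

lemma twisted_span_mult:
  assumes "x \<in> twisted_span k d" "y \<in> twisted_span k' d'"
  shows "x * y \<in> twisted_span (k + k') (d + d')"
proof -
  define a b where "a = \<i> ^ k * x" and "b = \<i> ^ k' * y"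
  have eq: "\<i> ^ (k + k') * (x * y) = a * b" by (simp add: a_def b_def power_add)
  have a: "Re a \<in> qspan (S_par False k d)" "Im a \<in> qspan (S_par True k d)"
    and b: "Re b \<in> qspan (S_par False k' d')" "Im b \<in> qspan (S_par True k' d')"
    using assms by (auto simp: twisted_span_def a_def b_def S_o_eq S_e_eq)
  have m: "x * y \<in> qspan (S_par (p \<noteq> q) (k + k') (d + d'))"
    if "x \<in> qspan (S_par p k d)" "y \<in> qspan (S_par q k' d')" for x y p q
    using that by (rule qspan_mult) (rule S_par_mult)
  have "Re a * Re b \<in> qspan (S_par False (k + k') (d + d'))" "Im a * Im b \<in> qspan (S_par False (k + k') (d + d'))"
    "Re a * Im b \<in> qspan (S_par True (k + k') (d + d'))" "Im a * Re b \<in> qspan (S_par True (k + k') (d + d'))"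
    using m[OF a(1) b(1)] m[OF a(2) b(2)] m[OF a(1) b(2)] m[OF a(2) b(1)] by auto
  thus ?thesis unfolding twisted_span_def mem_Collect_eq eq unfolding times_complex.sel S_o_eq S_e_eq
    by (blast intro: qspan_add qspan_diff)
qed

lemma SLs_Nil: "SLs [] = 1"
  by (simp add: SLs_def iter_int_def)

lemma twisted_span_1: "1 \<in> twisted_span 0 0"
proof -
  have "1 \<in> S_e 0 0" by (auto simp: S_e_def SLs_Nil)
  thus ?thesis by (simp add: twisted_span_def qspan_base qspan_0)
qed

text \<open>The twist by \<open>\<i>\<close> gives \<open>- pi\<close>, which is real and of depth
  \<open>0\<close>, hence even.\<close>

lemma twisted_span_pi: "\<i> * of_real pi \<in> twisted_span 1 0"
proof -
  have "pi \<in> S_e 1 0" by (auto simp: S_e_def SLs_Nil intro!: exI[of _ 1] exI[of _ "[]"])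
  hence "- pi \<in> qspan (S_e 1 0)" by (intro qspan_neg qspan_base)
  thus ?thesis by (simp add: twisted_span_def qspan_0)
qed

lemma twisted_span_power:
  assumes "x \<in> twisted_span k d"
  shows "x ^ n \<in> twisted_span (n * k) (n * d)"
  by (induction n) (use twisted_span_1 twisted_span_mult[OF assms] in auto)

lemma i_power_cases:
  "even k \<Longrightarrow> \<exists>s\<in>{1, -1}. \<i> ^ k = complex_of_real s" 
  "odd k \<Longrightarrow> \<exists>s\<in>{1, -1}. \<i> ^ k = \<i> * complex_of_real s"
proof -
  have *: "\<exists>s\<in>{1, -1}. \<i> ^ (2 * j) = complex_of_real s" for j
    by (cases "even j") (auto simp: power_mult)
  show "even k \<Longrightarrow> \<exists>s\<in>{1, -1}. \<i> ^ k = complex_of_real s" using * by (auto elim: evenE)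
  show "odd k \<Longrightarrow> \<exists>s\<in>{1, -1}. \<i> ^ k = \<i> * complex_of_real s" 
  proof -
    assume "odd k"
    then obtain j where k: "k = Suc (2 * j)" by (auto elim: oddE)
    obtain s where "s \<in> {1, -1}" "\<i> ^ (2 * j) = complex_of_real s" using * by blast
    thus ?thesis unfolding k power_Suc by auto
  qed
qed

lemma twisted_span_even_iff:
  assumes "even k"
  shows "x \<in> twisted_span k d \<longleftrightarrow> Re x \<in> qspan (S_e k d) \<and> Im x \<in> qspan (S_o k d)"
proof -
  obtain s where s: "s \<in> {1, -1}" "\<i> ^ k = complex_of_real s" using i_power_cases assms by blast
  show ?thesis unfolding twisted_span_def mem_Collect_eq s(2)
    using s(1) qspan_neg[of "Re x"] qspan_neg[of "- Re x"] qspan_neg[of "Im x"] qspan_neg[of "- Im x"]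
    by auto
qed

text \<open>An odd power of \<open>\<i>\<close> exchanges real and imaginary part up to
  sign.\<close>

lemma twisted_span_odd_iff:
  assumes "odd k"
  shows "x \<in> twisted_span k d \<longleftrightarrow> Re x \<in> qspan (S_o k d) \<and> Im x \<in> qspan (S_e k d)"
proof -
  obtain s where s: "s \<in> {1, -1}" "\<i> ^ k = \<i> * complex_of_real s" using i_power_cases assms by blast
  show ?thesis unfolding twisted_span_def mem_Collect_eq s(2)
    using s(1) qspan_neg[of "Re x"] qspan_neg[of "- Re x"] qspan_neg[of "Im x"] qspan_neg[of "- Im x"]
    by auto
qed

text \<open>Odd entries make the sum and the length of \<open>ks\<close> congruent modulo
  \<open>2\<close>, and the exponent of \<open>pi\<close> is even; so the depth has the parity of
  the weight.\<close>

lemma S'_subset: "S' k d \<subseteq> S_par (odd k) k d"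
proof
  fix x assume "x \<in> S' k d"
  then obtain m ks where x: "x = pi ^ (2 * m) * SLs ks" "2 * m + sum_list ks = k" "length ks \<le> d"
    "\<forall>x\<in>set ks. 3 \<le> x \<and> odd x" by (auto simp: S'_def)
  have "odd (sum_list ks) = odd (length ks)" using x(4) by (induction ks) auto
  hence "odd (length ks) = odd k" using x(2) by auto
  thus "x \<in> S_par (odd k) k d" unfolding S_par_def using x
    by (intro CollectI exI[of _ "2 * m"] exI[of _ ks]) auto
qed

lemma twisted_span_mzv:
  assumes "mzv ks \<in> qspan (S' (sum_list ks) (length ks))"
  shows "of_real (mzv ks) \<in> twisted_span (sum_list ks) (length ks)"
proof -
  let ?k = "sum_list ks"
  have "mzv ks \<in> qspan (S_par (odd ?k) ?k (length ks))"
    using assms qspan_mono[OF S'_subset] by blast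
  thus ?thesis
    by (cases "even ?k") (auto simp: twisted_span_even_iff twisted_span_odd_iff S_o_eq S_e_eq qspan_0)
qed

text \<open>Up to sign, \<open>Gl\<close> and \<open>Cl\<close> are the real and imaginary part of
  \<open>\<i> ^ k * Li_circ ks \<sigma>\<close> for weight \<open>k\<close>.\<close>

lemma twisted_span_Li_circ:
  assumes "Cl ks \<sigma> \<in> qspan (S_o (sum_list ks) (length ks))" "Gl ks \<sigma> \<in> qspan (S_e (sum_list ks) (length ks))"
  shows "Li_circ ks \<sigma> \<in> twisted_span (sum_list ks) (length ks)"
  using assms by (cases "even (sum_list ks)") (auto simp: twisted_span_even_iff twisted_span_odd_iff Cl_def Gl_def)

section \<open>Polynomials in polylogarithms on a circle\<close>

text \<open>
  The arguments of the functions are the radius \<open>r\<close> and the angle \<open>t\<close>. Powers of \<open>t\<close> enter only through \<open>base\<close>,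
  since integration does not commute with multiplication by \<open>t\<close>.
\<close>

inductive polylog_poly :: "nat \<Rightarrow> nat \<Rightarrow> (real \<Rightarrow> real \<Rightarrow> complex) \<Rightarrow> bool" where
  base: "\<forall>k\<in>set ks. 1 \<le> k \<Longrightarrow> polylog_poly (b + sum_list ks) (length ks)
           (\<lambda>r t. (\<i> * of_real t) ^ b * Li_rev ks (of_real r * cis t))"
| zeta: "\<forall>k\<in>set ks. 1 \<le> k \<Longrightarrow> admissible ks \<Longrightarrow> polylog_poly k d f \<Longrightarrow>
           polylog_poly (sum_list ks + k) (length ks + d) (\<lambda>r t. Li_rev (rev ks) (of_real r) * f r t)"
| pi: "polylog_poly k d f \<Longrightarrow> polylog_poly (Suc k) d (\<lambda>r t. \<i> * of_real pi * f r t)"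
| add: "polylog_poly k d f \<Longrightarrow> polylog_poly k d g \<Longrightarrow> polylog_poly k d (\<lambda>r t. f r t + g r t)"
| scale: "polylog_poly k d f \<Longrightarrow> q \<in> \<rat> \<Longrightarrow> polylog_poly k d (\<lambda>r t. of_real q * f r t)"
| mono: "polylog_poly k d f \<Longrightarrow> d \<le> d' \<Longrightarrow> polylog_poly k d' f"
| cong: "polylog_poly k d f \<Longrightarrow> (\<And>r t. 0 < r \<Longrightarrow> r < 1 \<Longrightarrow> 0 \<le> t \<Longrightarrow> f r t = g r t) \<Longrightarrow> polylog_poly k d g"

section \<open>Closure properties of polynomials in polylogarithms\<close>

lemma Li_rev_circle_continuous:
  assumes "\<forall>k\<in>set ks. 1 \<le> k" "0 < r" "r < 1"
  shows "continuous_on S (\<lambda>t. Li_rev ks (of_real r * cis t))"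
proof (rule continuous_on_eval_fps')
  show "(\<lambda>t. of_real r * cis t) ` S \<subseteq> eball 0 (fps_conv_radius (Li_fps ks))"
  proof clarify
    fix t
    show "of_real r * cis t \<in> eball 0 (fps_conv_radius (Li_fps ks))"
      using Li_fps_conv[OF assms(1), of "of_real r * cis t"] assms(2,3) by (simp add: norm_mult)
  qed
qed (auto simp: cis_conv_exp intro!: continuous_intros)

lemma polylog_poly_continuous:
  assumes "polylog_poly k d f" "0 < r" "r < 1"
  shows "continuous_on {0..} (f r)"
  using assms
proof (induction rule: polylog_poly.induct)
  case (base ks b)
  thus ?case
    by (intro continuous_on_mult continuous_on_power Li_rev_circle_continuous) (auto intro!: continuous_intros)
next
  case (cong k d f g)
  have "continuous_on {0..} (f r) = continuous_on {0..} (g r)"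
    using cong by (intro continuous_on_cong) auto
  thus ?case using cong by simp
qed (auto intro!: continuous_intros)

lemma polylog_poly_integrable:
  assumes "polylog_poly k d f" "0 < r" "r < 1"
  shows "(\<lambda>s. \<i> * f r s) integrable_on {0..t}"
  using continuous_on_subset[OF polylog_poly_continuous[OF assms], of "{0..t}"]
  by (intro integrable_continuous_real continuous_intros) auto

lemma polylog_poly_zero: "polylog_poly k d (\<lambda>_ _. 0)"
proof -
  have "polylog_poly k 0 (\<lambda>r t. of_real 0 * ((\<i> * of_real t) ^ k * Li_rev [] (of_real r * cis t)))"
    using scale[OF base[of "[]" k], of 0] by simp
  thus ?thesis using mono[of k 0 _ d] by simp
qed

lemma polylog_poly_sum_list:
  assumes "\<And>x. x \<in> set xs \<Longrightarrow> polylog_poly k d (f x)"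
  shows "polylog_poly k d (\<lambda>r t. \<Sum>x\<leftarrow>xs. f x r t)"
  using assms by (induction xs) (auto intro: polylog_poly_zero add)

lemma polylog_poly_theta:
  assumes "polylog_poly k d f"
  shows "polylog_poly (Suc k) d (\<lambda>r t. \<i> * of_real t * f r t)"
  using assms
proof (induction rule: polylog_poly.induct)
  case (base ks b)
  thus ?case using polylog_poly.base[of ks "Suc b"] by (simp add: mult.assoc)
next
  case (zeta ks k d f)
  thus ?case using polylog_poly.zeta[of ks "Suc k" d "\<lambda>r t. \<i> * of_real t * f r t"] by (simp add: mult_ac)
next
  case (pi k d f)
  thus ?case using polylog_poly.pi[of "Suc k" d "\<lambda>r t. \<i> * of_real t * f r t"] by (simp add: mult_ac)
next
  case (add k d f g)
  thus ?case using polylog_poly.add[of "Suc k" d] by (simp add: distrib_left)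
next
  case (scale k d f q)
  thus ?case using polylog_poly.scale[of "Suc k" d "\<lambda>r t. \<i> * of_real t * f r t" q] by (simp add: mult_ac)
next
  case (mono k d f d')
  thus ?case using polylog_poly.mono by blast
next
  case (cong k d f g)
  show ?case by (rule polylog_poly.cong[OF cong.IH]) (use cong in auto)
qed

text \<open>Only the base case needs an argument, the shuffle product; the other constructors
  commute with the multiplication.\<close>

lemma polylog_poly_Li_1:
  assumes "polylog_poly k d f"
  shows "polylog_poly (Suc k) (Suc d) (\<lambda>r t. Li_rev [1] (of_real r * cis t) * f r t)"
  using assms
proof (induction rule: polylog_poly.induct)
  case (base ks b)
  obtain js where js: "\<forall>j\<in>set js. is_index (Suc (sum_list ks)) (Suc (length ks)) j"
    "\<forall>z. norm z < 1 \<longrightarrow> Li_rev [1] z * Li_rev ks z = (\<Sum>j\<leftarrow>js. Li_rev j z)"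
    using Li_rev_shuffle_1[OF base] by blast
  have "polylog_poly (Suc (b + sum_list ks)) (Suc (length ks))
      (\<lambda>r t. \<Sum>j\<leftarrow>js. (\<i> * of_real t) ^ b * Li_rev j (of_real r * cis t))"
  proof (rule polylog_poly_sum_list)
    fix j assume "j \<in> set js"
    hence "is_index (Suc (sum_list ks)) (Suc (length ks)) j" using js by blast
    thus "polylog_poly (Suc (b + sum_list ks)) (Suc (length ks))
      (\<lambda>r t. (\<i> * of_real t) ^ b * Li_rev j (of_real r * cis t))"
      using polylog_poly.base[of j b] by (simp add: is_index_def)
  qed
  thus ?case
  proof (rule polylog_poly.cong)
    fix r t :: real assume "0 < r" "r < 1"
    hence "norm (of_real r * cis t) < 1" by (simp add: norm_mult)
    hence "Li_rev [1] (of_real r * cis t) * Li_rev ks (of_real r * cis t) = (\<Sum>j\<leftarrow>js. Li_rev j (of_real r * cis t))"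
      using js(2) by blast
    thus "(\<Sum>j\<leftarrow>js. (\<i> * of_real t) ^ b * Li_rev j (of_real r * cis t)) =
      Li_rev [1] (of_real r * cis t) * ((\<i> * of_real t) ^ b * Li_rev ks (of_real r * cis t))"
      by (simp add: sum_list_const_mult mult.left_commute)
  qed
next
  case (zeta ks k d f)
  thus ?case using polylog_poly.zeta[of ks "Suc k" "Suc d" "\<lambda>r t. Li_rev [1] (of_real r * cis t) * f r t"] by (simp add: mult_ac)
next
  case (pi k d f)
  thus ?case using polylog_poly.pi[of "Suc k" "Suc d" "\<lambda>r t. Li_rev [1] (of_real r * cis t) * f r t"] by (simp add: mult_ac)
next
  case (add k d f g)
  thus ?case using polylog_poly.add[of "Suc k" "Suc d"] by (simp add: distrib_left)
next
  case (scale k d f q)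
  thus ?case using polylog_poly.scale[of "Suc k" "Suc d" "\<lambda>r t. Li_rev [1] (of_real r * cis t) * f r t" q] by (simp add: mult_ac)
next
  case (mono k d f d')
  thus ?case using polylog_poly.mono[of "Suc k" "Suc d" _ "Suc d'"] by simp
next
  case (cong k d f g)
  show ?case by (rule polylog_poly.cong[OF cong.IH]) (use cong in auto)
qed

text \<open>For \<open>r < 1\<close>, \<open>A_disk\<close> is
  \<open>- Li_1 - \<i> * t / 2 + \<i> * pi / 2\<close>. The last two terms do not raise the depth
  and are lifted by \<open>mono\<close>.\<close>

lemma polylog_poly_A:
  assumes "polylog_poly k d f"
  shows "polylog_poly (Suc k) (Suc d) (\<lambda>r t. A_disk r t * f r t)"
proof -
  let ?L = "\<lambda>r t. Li_rev [1] (of_real r * cis t) * f r t"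
  let ?T = "\<lambda>r t. \<i> * of_real t * f r t" and ?P = "\<lambda>r t. \<i> * of_real pi * f r t"
  have L: "polylog_poly (Suc k) (Suc d) (\<lambda>r t. of_real (-1) * ?L r t)"
    by (intro scale polylog_poly_Li_1 assms) auto
  have T: "polylog_poly (Suc k) (Suc d) (\<lambda>r t. of_real (-1/2) * ?T r t)"
    by (intro scale mono[OF polylog_poly_theta[OF assms]]) auto
  have P: "polylog_poly (Suc k) (Suc d) (\<lambda>r t. of_real (1/2) * ?P r t)"
    by (intro scale mono[OF pi[OF assms]]) auto
  show ?thesis
  proof (rule cong[OF add[OF add[OF L T] P]])
    fix r t :: real assume "0 < r" "r < 1"
    hence "Li_rev [1] (of_real r * cis t) = - Ln (1 - of_real r * cis t)"
      by (intro Li_rev_1) (simp add: norm_mult)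
    thus "of_real (-1) * ?L r t + of_real (-1/2) * ?T r t + of_real (1/2) * ?P r t = A_disk r t * f r t"
      unfolding A_disk_def by (simp only:) (simp add: field_simps)
  qed
qed

text \<open>Along a circle \<open>d/dt\<close> equals \<open>\<i> * z * d/dz\<close>, which lowers
  the leading entry.\<close>

lemma Li_rev_circle_deriv:
  assumes "\<forall>k\<in>set ks. 1 \<le> k" "1 \<le> k" "0 < r" "r < 1"
  shows "((\<lambda>t. Li_rev (Suc k # ks) (of_real r * cis t)) has_vector_derivative
           \<i> * Li_rev (k # ks) (of_real r * cis t)) (at t within S)"
proof -
  let ?z = "of_real r * cis t"
  have z: "norm ?z < 1" using assms by (simp add: norm_mult)
  have a: "(Li_rev (Suc k # ks) has_field_derivative eval_fps (fps_deriv (Li_fps (Suc k # ks))) ?z)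
      (at ?z within (\<lambda>t. of_real r * cis t) ` S)"
    using assms z by (intro Li_rev_deriv) auto
  have "((\<lambda>t. of_real r * cis t) has_vector_derivative of_real r * (\<i> * cis t)) (at t within S)"
  proof (intro has_vector_derivative_mult_right)
    have "((\<lambda>z. exp (\<i> * z)) has_field_derivative \<i> * exp (\<i> * of_real t)) (at (of_real t))"
      by (auto intro!: derivative_eq_intros)
    from has_vector_derivative_real_field[OF this] show "(cis has_vector_derivative \<i> * cis t) (at t within S)"
      by (simp add: cis_conv_exp[abs_def])
  qed
  hence "((Li_rev (Suc k # ks) \<circ> (\<lambda>t. of_real r * cis t)) has_vector_derivative
      (of_real r * (\<i> * cis t)) * eval_fps (fps_deriv (Li_fps (Suc k # ks))) ?z) (at t within S)"
    using a by (rule field_vector_diff_chain_within)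
  moreover have "(of_real r * (\<i> * cis t)) * eval_fps (fps_deriv (Li_fps (Suc k # ks))) ?z
     = \<i> * (?z * eval_fps (fps_deriv (Li_fps (Suc k # ks))) ?z)" by (simp add: mult_ac)
  ultimately show ?thesis
    unfolding o_def using Li_rev_deriv_Suc[OF assms(1,2) z] by simp
qed

text \<open>Partial integration lowers the power of the angle and raises the leading entry, so the
  induction on \<open>b\<close> must leave \<open>k\<close> arbitrary. The empty index is a plain
  power of the angle.\<close>

lemma polylog_poly_integral_base:
  assumes "\<forall>k\<in>set ks. 1 \<le> k"
  shows "polylog_poly (Suc (b + sum_list ks)) (length ks)
     (\<lambda>r t. integral {0..t} (\<lambda>s. \<i> * ((\<i> * of_real s) ^ b * Li_rev ks (of_real r * cis s))))"
proof (cases ks)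
  case Nil
  have "polylog_poly (Suc b) 0 (\<lambda>r t. of_real (1 / real (Suc b)) * ((\<i> * of_real t) ^ Suc b * Li_rev [] (of_real r * cis t)))"
    using base[of "[]" "Suc b"] by (intro scale) auto
  moreover have "of_real (1 / real (Suc b)) * (\<i> * of_real t) ^ Suc b = integral {0..t} (\<lambda>s. \<i> * (\<i> * of_real s) ^ b)"
    if "0 \<le> t" for t
  proof -
    let ?F = "\<lambda>s::real. of_real (1 / real (Suc b)) * (\<i> * of_real s) ^ Suc b"
    have "((\<lambda>s. \<i> * (\<i> * of_real s) ^ b) has_integral (?F t - ?F 0)) {0..t}"
    proof (rule fundamental_theorem_of_calculus[OF that])
      fix s :: real
      have "((\<lambda>z. of_real (1 / real (Suc b)) * (\<i> * z) ^ Suc b) has_field_derivative \<i> * (\<i> * of_real s) ^ b) (at (of_real s))"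
        by (rule derivative_eq_intros refl | simp del: of_nat_Suc)+
      thus "(?F has_vector_derivative \<i> * (\<i> * of_real s) ^ b) (at s within {0..t})"
        by (rule has_vector_derivative_real_field)
    qed
    from integral_unique[OF this] show ?thesis by (simp del: integral_mult_right)
  qed
  ultimately show ?thesis using Nil by (auto intro: cong)
next
  case (Cons k ks')
  have "polylog_poly (Suc (b + sum_list (k # ks'))) (length (k # ks'))
     (\<lambda>r t. integral {0..t} (\<lambda>s. \<i> * ((\<i> * of_real s) ^ b * Li_rev (k # ks') (of_real r * cis s))))"
    if pos: "1 \<le> k" "\<forall>k\<in>set ks'. 1 \<le> k" for k
    using that
  proof (induction b arbitrary: k)
    case 0
    let ?H = "\<lambda>r t. Li_rev (Suc k # ks') (of_real r * cis t)"
    have "polylog_poly (0 + sum_list (Suc k # ks')) (length (Suc k # ks')) (\<lambda>r t. (\<i> * of_real t) ^ 0 * ?H r t)"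
      using 0 by (intro base) auto
    hence a: "polylog_poly (Suc (k + sum_list ks')) (Suc (length ks')) ?H" by simp
    \<comment> \<open>The integration constant is the value at \<open>t = 0\<close>. Its leading
      entry is at least \<open>2\<close>, so it is an admissible \<open>zeta\<close> factor; the
      reversals follow the order used by \<open>admissible\<close>.\<close>
    have "polylog_poly (sum_list (rev (Suc k # ks')) + 0) (length (rev (Suc k # ks')) + 0)
       (\<lambda>r t. Li_rev (rev (rev (Suc k # ks'))) (of_real r) * ((\<i> * of_real t) ^ 0 * Li_rev [] (of_real r * cis t)))"
      using 0 base[of "[]" 0] by (intro zeta) (auto simp: admissible_def)
    hence "polylog_poly (Suc (k + sum_list ks')) (Suc (length ks')) (\<lambda>r t. Li_rev (Suc k # ks') (of_real r))"
      by (simp add: add_ac)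
    hence c: "polylog_poly (Suc (k + sum_list ks')) (Suc (length ks')) (\<lambda>r t. of_real (-1) * Li_rev (Suc k # ks') (of_real r))"
      by (rule scale) auto
    have "polylog_poly (Suc (k + sum_list ks')) (Suc (length ks'))
      (\<lambda>r t. integral {0..t} (\<lambda>s. \<i> * Li_rev (k # ks') (of_real r * cis s)))"
    proof (rule cong[OF add[OF a c]])
      fix r t :: real assume r: "0 < r" "r < 1" and t: "0 \<le> t"
      have "((\<lambda>s. \<i> * Li_rev (k # ks') (of_real r * cis s)) has_integral (?H r t - ?H r 0)) {0..t}"
        using 0 r by (intro fundamental_theorem_of_calculus[OF t] Li_rev_circle_deriv) auto
      from integral_unique[OF this] show "?H r t + of_real (-1) * Li_rev (Suc k # ks') (of_real r) =
          integral {0..t} (\<lambda>s. \<i> * Li_rev (k # ks') (of_real r * cis s))"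
        by (simp del: integral_mult_right)
    qed
    thus ?case by simp
  next
    case (Suc b)
    let ?H = "\<lambda>r t. Li_rev (Suc k # ks') (of_real r * cis t)"
    let ?w = "Suc (Suc (b + (k + sum_list ks')))" and ?n = "Suc (length ks')"
    have "polylog_poly (Suc b + sum_list (Suc k # ks')) (length (Suc k # ks')) (\<lambda>r t. (\<i> * of_real t) ^ Suc b * ?H r t)"
      using Suc.prems by (intro base) auto
    hence a: "polylog_poly ?w ?n (\<lambda>r t. (\<i> * of_real t) ^ Suc b * ?H r t)" by simp
    have "polylog_poly ?w ?n (\<lambda>r t. integral {0..t} (\<lambda>s. \<i> * ((\<i> * of_real s) ^ b * ?H r s)))"
      using Suc.IH[of "Suc k"] Suc.prems by simp
    hence c: "polylog_poly ?w ?n (\<lambda>r t. of_real (- real (Suc b)) * integral {0..t} (\<lambda>s. \<i> * ((\<i> * of_real s) ^ b * ?H r s)))"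
      by (rule scale) auto
    have "polylog_poly ?w ?n
      (\<lambda>r t. integral {0..t} (\<lambda>s. \<i> * ((\<i> * of_real s) ^ Suc b * Li_rev (k # ks') (of_real r * cis s))))"
    proof (rule cong[OF add[OF a c]])
      fix r t :: real assume r: "0 < r" "r < 1" and t: "0 \<le> t"
      let ?f = "\<lambda>s. \<i> * ((\<i> * of_real s) ^ Suc b * Li_rev (k # ks') (of_real r * cis s))"
      let ?g = "\<lambda>s. \<i> * ((\<i> * of_real s) ^ b * ?H r s)"
      have fi: "?f integrable_on {0..t}" and gi: "?g integrable_on {0..t}"
        using Suc.prems r
        by (intro integrable_continuous_real continuous_on_mult continuous_on_power continuous_on_of_real
              continuous_on_id continuous_on_const Li_rev_circle_continuous; simp)+
      have "((\<lambda>s. of_real (real (Suc b)) * ?g s + ?f s) has_integral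
            ((\<i> * of_real t) ^ Suc b * ?H r t - (\<i> * of_real 0) ^ Suc b * ?H r 0)) {0..t}"
      proof (rule fundamental_theorem_of_calculus[OF t])
        fix s :: real
        have "((\<lambda>z. (\<i> * z) ^ Suc b) has_field_derivative of_nat (Suc b) * (\<i> * (\<i> * of_real s) ^ b)) (at (of_real s))"
          by (rule derivative_eq_intros refl | simp del: of_nat_Suc)+
        hence "((\<lambda>s. (\<i> * of_real s) ^ Suc b) has_vector_derivative of_nat (Suc b) * (\<i> * (\<i> * of_real s) ^ b)) (at s within {0..t})"
          by (rule has_vector_derivative_real_field)
        moreover have "(?H r has_vector_derivative \<i> * Li_rev (k # ks') (of_real r * cis s)) (at s within {0..t})"
          using Suc.prems r by (intro Li_rev_circle_deriv) auto
        ultimately have "((\<lambda>s. (\<i> * of_real s) ^ Suc b * ?H r s) has_vector_derivative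
            (\<i> * of_real s) ^ Suc b * (\<i> * Li_rev (k # ks') (of_real r * cis s)) +
            of_nat (Suc b) * (\<i> * (\<i> * of_real s) ^ b) * ?H r s) (at s within {0..t})"
          by (rule has_vector_derivative_mult)
        thus "((\<lambda>s. (\<i> * of_real s) ^ Suc b * ?H r s) has_vector_derivative
            (of_real (real (Suc b)) * ?g s + ?f s)) (at s within {0..t})"
          by (simp add: algebra_simps)
      qed
      \<comment> \<open>The boundary term at \<open>0\<close> vanishes because of the positive power
        of the angle; a constant arises only for \<open>b = 0\<close>.\<close>
      from integral_unique[OF this]
      have "(\<i> * of_real t) ^ Suc b * ?H r t = integral {0..t} (\<lambda>s. of_real (real (Suc b)) * ?g s + ?f s)"
        by simp
      also have "\<dots> = of_real (real (Suc b)) * integral {0..t} ?g + integral {0..t} ?f"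
        using fi gi by (subst integral_add) (auto intro!: integrable_on_mult_right simp del: of_nat_Suc of_real_of_nat_eq)
      finally show "(\<i> * of_real t) ^ Suc b * ?H r t + of_real (- real (Suc b)) * integral {0..t} ?g = integral {0..t} ?f"
        unfolding of_real_minus mult_minus_left
        by (simp only: add_diff_cancel_left' flip: diff_conv_add_uminus)
    qed
    thus ?case by simp
  qed
  thus ?thesis using assms Cons by simp
qed

lemma polylog_poly_integral:
  assumes "polylog_poly k d f"
  shows "polylog_poly (Suc k) d (\<lambda>r t. integral {0..t} (\<lambda>s. \<i> * f r s))"
  using assms
proof (induction rule: polylog_poly.induct)
  case (base ks b)
  thus ?case by (rule polylog_poly_integral_base)
next
  case (zeta ks k d f)
  have "integral {0..t} (\<lambda>s. \<i> * (c * f r s)) = c * integral {0..t} (\<lambda>s. \<i> * f r s)" for c r t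
    by (simp add: mult.left_commute)
  thus ?case using polylog_poly.zeta[OF zeta.hyps(1,2) zeta.IH] by (simp add: mult.left_commute)
next
  case (pi k d f)
  have "integral {0..t} (\<lambda>s. \<i> * (c * f r s)) = c * integral {0..t} (\<lambda>s. \<i> * f r s)" for c r t
    by (simp add: mult.left_commute)
  thus ?case using polylog_poly.pi[OF pi.IH] by (simp add: mult.left_commute)
next
  case (add k d f g)
  show ?case
  proof (rule polylog_poly.cong[OF polylog_poly.add[OF add.IH]])
    fix r t :: real assume r: "0 < r" "r < 1"
    show "integral {0..t} (\<lambda>s. \<i> * f r s) + integral {0..t} (\<lambda>s. \<i> * g r s) =
          integral {0..t} (\<lambda>s. \<i> * (f r s + g r s))"
      unfolding distrib_left
      by (rule integral_add[symmetric]) (use add.hyps r polylog_poly_integrable in auto)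
  qed
next
  case (scale k d f q)
  have "integral {0..t} (\<lambda>s. \<i> * (c * f r s)) = c * integral {0..t} (\<lambda>s. \<i> * f r s)" for c r t
    by (simp add: mult.left_commute)
  thus ?case using polylog_poly.scale[OF scale.IH scale.hyps(2)] by (simp add: mult.left_commute)
next
  case (mono k d f d')
  thus ?case using polylog_poly.mono by blast
next
  case (cong k d f g)
  show ?case
    by (rule polylog_poly.cong[OF cong.IH]) (use cong in \<open>auto intro!: integral_cong\<close>)
qed

text \<open>The radial limit is taken generator by generator, where the hypotheses put every factor
  into a twisted span. A rational multiple of \<open>pi\<close> is required as angle so that
  \<open>\<i> * \<sigma>\<close> is a rational multiple of \<open>\<i> * pi\<close>.\<close>

lemma polylog_poly_tendsto:
  assumes hypA: "\<forall>ks. (\<forall>k\<in>set ks. 1 \<le> k) \<and> admissible ks \<longrightarrow>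
                   mzv ks \<in> qspan (S' (sum_list ks) (length ks))"
    and hypB: "\<forall>ks. (\<forall>k\<in>set ks. 1 \<le> k) \<longrightarrow>
                   Cl ks \<sigma> \<in> qspan (S_o (sum_list ks) (length ks)) \<and>
                   Gl ks \<sigma> \<in> qspan (S_e (sum_list ks) (length ks))"
    and \<sigma>0: "0 \<le> \<sigma>"
    and \<sigma>: "0 < sin \<sigma>" "\<sigma> = q * pi" "q \<in> \<rat>"
    and f: "polylog_poly k d f"
  shows "\<exists>x\<in>twisted_span k d. ((\<lambda>r. f r \<sigma>) \<longlongrightarrow> x) (at_left 1)"
  using f
proof (induction rule: polylog_poly.induct)
  case (base ks b)
  have "of_real q * (\<i> * of_real pi) \<in> twisted_span 1 0"
    by (intro twisted_span_scale twisted_span_pi \<sigma>)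
  hence "\<i> * of_real \<sigma> \<in> twisted_span 1 0" by (simp add: \<sigma>(2) mult_ac)
  from twisted_span_power[OF this, of b] have "(\<i> * of_real \<sigma>) ^ b \<in> twisted_span b 0" by simp
  moreover have "Li_circ (rev ks) \<sigma> \<in> twisted_span (sum_list ks) (length ks)"
    using twisted_span_Li_circ[of "rev ks" \<sigma>] hypB[rule_format, of "rev ks"] base by simp
  ultimately have "(\<i> * of_real \<sigma>) ^ b * Li_circ (rev ks) \<sigma> \<in> twisted_span (b + sum_list ks) (length ks)"
    using twisted_span_mult by fastforce
  moreover have "((\<lambda>r. Li_rev ks (of_real r * cis \<sigma>)) \<longlongrightarrow> Li_circ (rev ks) \<sigma>) (at_left 1)"
    using Li_rev_tendsto_Li_circ[of "rev ks" \<sigma>] base \<sigma> by simp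
  ultimately show ?case by (intro bexI[rotated]) (auto intro!: tendsto_intros)
next
  case (zeta ks k d f)
  then obtain x where x: "x \<in> twisted_span k d" "((\<lambda>r. f r \<sigma>) \<longlongrightarrow> x) (at_left 1)" by blast
  have "of_real (mzv ks) * x \<in> twisted_span (sum_list ks + k) (length ks + d)"
    using zeta.hyps hypA x by (intro twisted_span_mult twisted_span_mzv) auto
  moreover have "((\<lambda>r. Li_rev (rev ks) (of_real r)) \<longlongrightarrow> of_real (mzv ks)) (at_left 1)"
    using zeta.hyps by (intro Li_rev_tendsto_mzv) auto
  ultimately show ?case using x(2) by (intro bexI[rotated]) (auto intro!: tendsto_intros)
next
  case (pi k d f)
  then obtain x where x: "x \<in> twisted_span k d" "((\<lambda>r. f r \<sigma>) \<longlongrightarrow> x) (at_left 1)" by blast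
  have "(\<i> * of_real pi) * x \<in> twisted_span (1 + k) (0 + d)" by (intro twisted_span_mult twisted_span_pi x)
  thus ?case using x(2) by (intro bexI[rotated]) (auto intro!: tendsto_intros)
next
  case (add k d f g)
  then obtain x y where "x \<in> twisted_span k d" "((\<lambda>r. f r \<sigma>) \<longlongrightarrow> x) (at_left 1)"
     "y \<in> twisted_span k d" "((\<lambda>r. g r \<sigma>) \<longlongrightarrow> y) (at_left 1)" by blast
  thus ?case by (intro bexI[of _ "x + y"] twisted_span_add tendsto_add)
next
  case (scale k d f q)
  then obtain x where "x \<in> twisted_span k d" "((\<lambda>r. f r \<sigma>) \<longlongrightarrow> x) (at_left 1)" by blast
  thus ?case using scale.hyps by (intro bexI[of _ "of_real q * x"] twisted_span_scale tendsto_intros)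
next
  case (mono k d f d')
  thus ?case using twisted_span_mono by blast
next
  case (cong k d f g)
  then obtain x where x: "x \<in> twisted_span k d" "((\<lambda>r. f r \<sigma>) \<longlongrightarrow> x) (at_left 1)" by blast
  have "\<forall>\<^sub>F r in at_left 1. f r \<sigma> = g r \<sigma>"

    using eventually_at_left_real[OF zero_less_one] by eventually_elim (use cong.hyps \<sigma>0 in auto)
  from Lim_transform_eventually[OF x(2) this] x(1) show ?case by (rule bexI)
qed

section \<open>The limit of the iterated integrals\<close>

text \<open>A pair \<open>(l, m)\<close> holds the exponents of the angle and of
  \<open>A_disk\<close>, outermost first. The factors \<open>\<i>\<close> on the angle and on the
  differential make this a \<open>polylog_poly\<close> and account for \<open>\<i> ^ (l + 1)\<close>
  per pair.\<close>

primrec disk_iter_int :: "(nat \<times> nat) list \<Rightarrow> real \<Rightarrow> real \<Rightarrow> complex" where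
  "disk_iter_int [] r t = 1"
| "disk_iter_int (p # ps) r t = integral {0..t}
     (\<lambda>s. \<i> * ((\<i> * of_real s) ^ fst p * (A_disk r s ^ snd p * disk_iter_int ps r s)))"

lemma polylog_poly_theta_power:
  "polylog_poly k d f \<Longrightarrow> polylog_poly (l + k) d (\<lambda>r t. (\<i> * of_real t) ^ l * f r t)"
  by (induction l) (use polylog_poly_theta in \<open>fastforce simp: mult.assoc\<close>)+

lemma polylog_poly_A_power:
  "polylog_poly k d f \<Longrightarrow> polylog_poly (m + k) (m + d) (\<lambda>r t. A_disk r t ^ m * f r t)"
  by (induction m) (use polylog_poly_A in \<open>fastforce simp: mult.assoc\<close>)+

text \<open>Angles and integrations raise the weight alone, whereas each \<open>A_disk\<close>
  raises weight and depth; this is the origin of the depth bound \<open>d\<close>.\<close>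

lemma polylog_poly_disk_iter_int:
  "polylog_poly (\<Sum>(l, m)\<leftarrow>ps. l + 1 + m) (\<Sum>(l, m)\<leftarrow>ps. m) (disk_iter_int ps)"
proof (induction ps)
  case Nil
  have eq: "disk_iter_int [] = (\<lambda>r t. 1)" by (intro ext) simp
  show ?case using base[of "[]" 0] by (simp add: eq)
next
  case (Cons p ps)
  have eq: "disk_iter_int (p # ps) = (\<lambda>r t. integral {0..t}
      (\<lambda>s. \<i> * ((\<i> * of_real s) ^ fst p * (A_disk r s ^ snd p * disk_iter_int ps r s))))"
    by (intro ext) simp
  show ?case
    using polylog_poly_integral[OF polylog_poly_theta_power[OF polylog_poly_A_power[OF Cons, of "snd p"], of "fst p"]]
    unfolding eq by (simp add: case_prod_unfold add.assoc)
qed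

lemma integral_Ioc_eq_Icc:
  fixes f :: "real \<Rightarrow> 'a :: banach"
  shows "integral {0<..\<sigma>} f = integral {0..\<sigma>} f"
  by (rule integral_spike_set) (auto intro: negligible_subset[of "{0}"])

lemma integrable_Ioc_iff_Icc:
  fixes f :: "real \<Rightarrow> 'a :: banach"
  shows "f integrable_on {0<..\<sigma>} \<longleftrightarrow> f integrable_on {0..\<sigma>}"
  by (rule integrable_spike_set_eq) (auto intro: negligible_subset[of "{0}"])

text \<open>Dominated convergence, one integration at a time. The uniform bound is proved together
  with the limit because it enters the majorant of the next integral.\<close>

lemma disk_iter_int_limit:
  assumes r: "\<And>n. 1/2 \<le> r n" "\<And>n. r n < 1" "filterlim r (at_left 1) sequentially"
  shows "(\<exists>C\<ge>0. \<forall>n. \<forall>\<sigma>\<in>{0..pi/3}. norm (disk_iter_int ps (r n) \<sigma>) \<le> C) \<and>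
         (\<forall>\<sigma>\<in>{0..pi/3}. (\<lambda>n. disk_iter_int ps (r n) \<sigma>) \<longlonglongrightarrow>
            \<i> ^ (\<Sum>(l, m)\<leftarrow>ps. l + 1) * of_real (iter_int_rev (map (\<lambda>(l, m) \<theta>. \<theta> ^ l * A_fun \<theta> ^ m) ps) \<sigma>))"
proof (induction ps)
  case Nil
  show ?case by (auto intro!: exI[of _ 1])
next
  case (Cons p ps)
  obtain l m where p: "p = (l, m)" by force
  define \<phi> where "\<phi> = (\<lambda>(l::nat, m::nat) \<theta>. \<theta> ^ l * A_fun \<theta> ^ m)"
  define w where "w = (\<Sum>(l, m)\<leftarrow>ps. l + 1)"
  define I where "I = iter_int_rev (map \<phi> ps)"
  obtain C where C: "0 \<le> C" "\<And>n \<sigma>. \<sigma> \<in> {0..pi/3} \<Longrightarrow> norm (disk_iter_int ps (r n) \<sigma>) \<le> C"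
    using Cons by blast
  have lim: "(\<lambda>n. disk_iter_int ps (r n) \<sigma>) \<longlonglongrightarrow> \<i> ^ w * of_real (I \<sigma>)" if "\<sigma> \<in> {0..pi/3}" for \<sigma>
    using Cons that unfolding w_def I_def \<phi>_def by blast
  obtain K where K: "\<forall>t\<in>{0<..2::real}. (10 + \<bar>ln t\<bar>) ^ m \<le> K * t powr (-1/2)"
    using ln_power_le_powr[of 10 m] by auto
  define F where "F = (\<lambda>n s. \<i> * ((\<i> * of_real s) ^ l * (A_disk (r n) s ^ m * disk_iter_int ps (r n) s)))"
  \<comment> \<open>The factors bound in turn the power of the angle, the power of
    \<open>A_disk\<close> and the inner integral, uniformly in \<open>n\<close>.\<close>
  define h where "h = (\<lambda>s::real. ((pi/3) ^ l * K * C) * s powr (-1/2))"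
  have Fh: "norm (F n s) \<le> h s" if s: "s \<in> {0<..pi/3}" for n s
  proof -
    have "norm (A_disk (r n) s) \<le> 10 + \<bar>ln s\<bar>"
      using s r(1)[of n] less_imp_le[OF r(2)[of n]] by (intro norm_A_disk_le) auto
    hence "norm (A_disk (r n) s) ^ m \<le> (10 + \<bar>ln s\<bar>) ^ m" by (intro power_mono) auto
    also have "\<dots> \<le> K * s powr (-1/2)" using K s pi_less_4 by auto
    finally have a: "norm (A_disk (r n) s) ^ m \<le> K * s powr (-1/2)" .
    have b: "0 \<le> K * s powr (-1/2)" using a by (meson norm_ge_zero order_trans zero_le_power)
    have "norm (F n s) = s ^ l * (norm (A_disk (r n) s) ^ m * norm (disk_iter_int ps (r n) s))"
      using s by (simp add: F_def norm_mult norm_power)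
    also have "\<dots> \<le> (pi/3) ^ l * ((K * s powr (-1/2)) * C)"
      using s a b C by (intro mult_mono power_mono) auto
    finally show ?thesis by (simp add: h_def mult_ac)
  qed
  have hint: "h integrable_on {0..\<sigma>}" if "0 \<le> \<sigma>" for \<sigma>
    unfolding h_def using integrable_on_powr_from_0[of "-1/2" \<sigma>] that
    by (intro integrable_on_mult_right) auto
  have Fint: "F n integrable_on {0..\<sigma>}" for n \<sigma>
  proof -
    \<comment> \<open>Inside the disk the integrand is continuous, which follows from the closure
      properties.\<close>
    have "polylog_poly (l + (m + (\<Sum>(l, m)\<leftarrow>ps. l + 1 + m))) (m + (\<Sum>(l, m)\<leftarrow>ps. m))
       (\<lambda>r t. (\<i> * of_real t) ^ l * (A_disk r t ^ m * disk_iter_int ps r t))"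
      by (intro polylog_poly_theta_power polylog_poly_A_power polylog_poly_disk_iter_int)
    moreover have "0 < r n" using r(1)[of n] by simp
    ultimately show ?thesis unfolding F_def using r(2) by (rule polylog_poly_integrable)
  qed
  have Flim: "(\<lambda>n. F n s) \<longlonglongrightarrow> \<i> ^ (l + 1 + w) * of_real (\<phi> p s * I s)" if s: "s \<in> {0<..pi/3}" for s
  proof -
    have "(\<lambda>n. A_disk (r n) s) \<longlonglongrightarrow> of_real (A_fun s)"
      using filterlim_compose[OF A_disk_tendsto[OF s] r(3)] .
    hence "(\<lambda>n. F n s) \<longlonglongrightarrow> \<i> * ((\<i> * of_real s) ^ l * (of_real (A_fun s) ^ m * (\<i> ^ w * of_real (I s))))"
      unfolding F_def using s by (intro tendsto_intros lim) auto
    thus ?thesis by (simp add: p \<phi>_def power_add power_mult_distrib mult_ac)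
  qed
  have "continuous_on {0..pi/3} I" unfolding I_def
  proof (rule iter_int_rev_continuous)
    have "sqrt_dominated (pi/3) (\<lambda>\<theta>. A_fun \<theta> ^ m * \<theta> ^ l)" for l m
      by (intro sqrt_dominated_mult A_fun_power_dominated continuous_intros)
    thus "\<forall>f\<in>set (map \<phi> ps). sqrt_dominated (pi/3) f"
      by (auto simp: \<phi>_def mult.commute)
  qed simp
  hence dom: "sqrt_dominated (pi/3) (\<lambda>s. A_fun s ^ m * (s ^ l * I s))"
    by (intro sqrt_dominated_mult A_fun_power_dominated continuous_intros)
  have main: "(\<lambda>n. disk_iter_int (p # ps) (r n) \<sigma>) \<longlonglongrightarrow> \<i> ^ (l + 1 + w) * of_real (iter_int_rev (map \<phi> (p # ps)) \<sigma>)"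
    if \<sigma>: "\<sigma> \<in> {0..pi/3}" for \<sigma>
  proof -
    \<comment> \<open>Majorant and pointwise limit are available for positive angles only, so the
      null set \<open>{0}\<close> is left out.\<close>
    have "(\<lambda>n. integral {0<..\<sigma>} (F n)) \<longlonglongrightarrow> integral {0<..\<sigma>} (\<lambda>s. \<i> ^ (l + 1 + w) * of_real (\<phi> p s * I s))"
    proof (rule dominated_convergence(2))
      show "F n integrable_on {0<..\<sigma>}" for n using Fint by (simp add: integrable_Ioc_iff_Icc)
      show "h integrable_on {0<..\<sigma>}" using hint \<sigma> by (simp add: integrable_Ioc_iff_Icc)
    qed (use \<sigma> Fh Flim in auto)
    moreover have "integral {0..\<sigma>} (\<lambda>s. \<i> ^ (l + 1 + w) * of_real (\<phi> p s * I s)) =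
        \<i> ^ (l + 1 + w) * of_real (integral {0..\<sigma>} (\<lambda>s. \<phi> p s * I s))"
    proof -
      have "(\<lambda>s. A_fun s ^ m * (s ^ l * I s)) integrable_on {0..pi/3}"
        using dom by (intro sqrt_dominated_integrable) auto
      hence "(\<lambda>s. A_fun s ^ m * (s ^ l * I s)) integrable_on {0..\<sigma>}"
        by (rule integrable_on_subinterval) (use \<sigma> in auto)
      hence "(\<lambda>s. \<phi> p s * I s) integrable_on {0..\<sigma>}"
        by (simp add: p \<phi>_def mult_ac)
      hence "((\<lambda>s. of_real (\<phi> p s * I s) :: complex) has_integral of_real (integral {0..\<sigma>} (\<lambda>s. \<phi> p s * I s))) {0..\<sigma>}"
        by (intro has_integral_of_real integrable_integral)
      from integral_unique[OF this] show ?thesis by simp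
    qed
    ultimately show ?thesis
      unfolding integral_Ioc_eq_Icc by (simp add: F_def p I_def)
  qed
  have bound: "norm (disk_iter_int (p # ps) (r n) \<sigma>) \<le> integral {0..pi/3} h" if \<sigma>: "\<sigma> \<in> {0..pi/3}" for n \<sigma>
  proof -
    have "norm (integral {0<..\<sigma>} (F n)) \<le> integral {0<..\<sigma>} h"
      using \<sigma> Fint hint Fh by (intro integral_norm_bound_integral) (auto simp: integrable_Ioc_iff_Icc)
    also have "\<dots> \<le> integral {0<..pi/3} h"
    proof (rule integral_subset_le)
      show "\<forall>x\<in>{0<..pi/3}. 0 \<le> h x" using order_trans[OF norm_ge_zero Fh] by blast
    qed (use \<sigma> hint in \<open>auto simp: integrable_Ioc_iff_Icc\<close>)
    finally show ?thesis by (simp add: integral_Ioc_eq_Icc F_def p)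
  qed
  have "0 \<le> integral {0..pi/3} h"
    using bound[of 0 0] by (meson atLeastAtMost_iff norm_ge_zero order_refl order_trans pi_ge_zero divide_nonneg_nonneg zero_le_numeral)
  thus ?case using bound main unfolding \<phi>_def w_def by (auto simp: p)
qed

section \<open>Reading off the parity at the angle \<open>pi/3\<close>\<close>

text \<open>The twist by \<open>\<i> ^ (e + d)\<close> turns \<open>\<i> ^ e\<close> into
  \<open>\<i> ^ d\<close> up to sign, so the parity of \<open>d\<close> alone decides whether
  \<open>I\<close> appears in the real or in the imaginary part.\<close>

lemma real_of_twisted_span:
  assumes "\<i> ^ e * of_real I \<in> twisted_span (e + d) d"
  shows "(odd d \<longrightarrow> I \<in> qspan (S_o (e + d) d)) \<and> (even d \<longrightarrow> I \<in> qspan (S_e (e + d) d))"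
proof (cases "even e")
  case True
  then obtain s where s: "s \<in> {1, -1}" "\<i> ^ e = complex_of_real s" using i_power_cases by blast
  hence x: "complex_of_real (s * I) \<in> twisted_span (e + d) d" using assms by simp
  have I: "I = s * (s * I)" "s \<in> \<rat>" using s by auto
  show ?thesis using x True
    by (cases "even d") (auto simp: twisted_span_even_iff twisted_span_odd_iff intro: qspan_scale[of "s * I" _ s, folded I(1)] I(2))
next
  case False
  then obtain s where s: "s \<in> {1, -1}" "\<i> ^ e = \<i> * complex_of_real s" using i_power_cases by blast
  hence x: "\<i> * complex_of_real (s * I) \<in> twisted_span (e + d) d" using assms by (simp add: mult.assoc)
  have I: "I = s * (s * I)" "s \<in> \<rat>" using s by auto
  show ?thesis using x False
    by (cases "even d") (auto simp: twisted_span_even_iff twisted_span_odd_iff intro: qspan_scale[of "s * I" _ s, folded I(1)] I(2))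
qed

theorem theorem10:
  assumes hypA: "\<forall>ks. (\<forall>k\<in>set ks. 1 \<le> k) \<and> admissible ks \<longrightarrow>
                   mzv ks \<in> qspan (S' (sum_list ks) (length ks))"
    and hypB: "\<forall>ks. (\<forall>k\<in>set ks. 1 \<le> k) \<longrightarrow>
                   Cl ks (pi/3) \<in> qspan (S_o (sum_list ks) (length ks)) \<and>
                   Gl ks (pi/3) \<in> qspan (S_e (sum_list ks) (length ks))"
    and pos: "\<forall>k\<in>set ks. 1 \<le> k"
    and len: "length ls = length ks"
    and bnd: "\<forall>u<length ks. ls ! u + 1 \<le> ks ! u"
    and d_def: "d = (\<Sum>u<length ks. ks ! u - 1 - ls ! u)"
  shows "(odd d \<longrightarrow> Ls ks ls (pi/3) \<in> qspan (S_o (sum_list ks) d)) \<and>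
         (even d \<longrightarrow> Ls ks ls (pi/3) \<in> qspan (S_e (sum_list ks) d))"
proof -
  \<comment> \<open>Reversed to the order of \<open>iter_int_rev\<close>; the pairs are the
    exponents of the angle and of \<open>A_fun\<close>.\<close>
  define ps where "ps = rev (map (\<lambda>(k, l). (l, k - 1 - l)) (zip ks ls))"
  define \<phi> where "\<phi> = (\<lambda>(l::nat, m::nat) \<theta>. \<theta> ^ l * A_fun \<theta> ^ m)"
  define I where "I = iter_int_rev (map \<phi> ps) (pi/3)"
  define e where "e = (\<Sum>(l, m)\<leftarrow>ps. l + 1)"
  have Ls: "Ls ks ls (pi/3) = (-1) ^ length ks * I"
    unfolding Ls_def I_def iter_int_def ps_def \<phi>_def
    by (simp add: rev_map o_def case_prod_unfold)
  have d: "(\<Sum>(l, m)\<leftarrow>ps. m) = d"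
  proof -
    have "(\<Sum>(l, m)\<leftarrow>ps. m) = (\<Sum>(k, l)\<leftarrow>zip ks ls. k - 1 - l)"
      by (simp add: ps_def rev_map[symmetric] sum_list_rev o_def case_prod_unfold)
    also have "\<dots> = d"
      unfolding d_def sum_list_sum_nth using len by (auto simp: atLeast0LessThan intro!: sum.cong)
    finally show ?thesis .
  qed
  have w: "(\<Sum>(l, m)\<leftarrow>ps. l + 1 + m) = sum_list ks"
  proof -
    have "(\<Sum>(l, m)\<leftarrow>ps. l + 1 + m) = (\<Sum>(k, l)\<leftarrow>zip ks ls. l + 1 + (k - 1 - l))"
      by (simp add: ps_def rev_map[symmetric] sum_list_rev o_def case_prod_unfold)
    \<comment> \<open>By \<open>bnd\<close> the subtraction of naturals is not truncated.\<close>
    also have "\<dots> = (\<Sum>(k, l)\<leftarrow>zip ks ls. k)"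
      using bnd len by (intro arg_cong[where f = sum_list] map_cong) (force simp: in_set_zip)+
    also have "\<dots> = sum_list ks"
      using len by (simp add: case_prod_unfold)
    finally show ?thesis .
  qed
  have ed: "e + d = sum_list ks"
    unfolding e_def d[symmetric] w[symmetric] by (induction ps) auto

  have sin: "0 < sin (pi/3)" by (intro sin_gt_zero) auto
  have third: "0 \<le> pi/3" "pi/3 = 1/3 * pi" "1/3 \<in> (\<rat> :: real set)" by auto
  have "polylog_poly (sum_list ks) d (disk_iter_int ps)"
    using polylog_poly_disk_iter_int[of ps] unfolding d w .
  from polylog_poly_tendsto[OF hypA hypB third(1) sin third(2,3) this]
  obtain x where x: "x \<in> twisted_span (e + d) d" "((\<lambda>r. disk_iter_int ps r (pi/3)) \<longlongrightarrow> x) (at_left 1)"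
    unfolding ed by blast
  \<comment> \<open>The shift by \<open>2\<close> keeps the radii at least \<open>1/2\<close>, as
    the uniform bound on \<open>A_disk\<close> requires.\<close>
  define r where "r = (\<lambda>n. 1 - 1 / real (n + 2))"
  have r: "1/2 \<le> r n" "r n < 1" for n by (auto simp: r_def field_simps)
  have "r \<longlonglongrightarrow> 1 - 0"
    unfolding r_def by (intro tendsto_diff tendsto_const LIMSEQ_ignore_initial_segment[OF lim_1_over_n])
  hence rl: "filterlim r (at_left 1) sequentially"
    by (simp add: filterlim_at less_imp_neq[OF r(2)] r(2))
  have "(\<lambda>n. disk_iter_int ps (r n) (pi/3)) \<longlonglongrightarrow> \<i> ^ e * of_real I"
    using disk_iter_int_limit[OF r rl, of ps] unfolding e_def I_def \<phi>_def by simp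
  moreover have "(\<lambda>n. disk_iter_int ps (r n) (pi/3)) \<longlonglongrightarrow> x"
    using filterlim_compose[OF x(2) rl] .
  \<comment> \<open>The limit computed by dominated convergence is the one located by algebra in the
    twisted span.\<close>
  ultimately have "\<i> ^ e * of_real I = x" by (rule LIMSEQ_unique)
  hence "\<i> ^ e * of_real I \<in> twisted_span (e + d) d" using x by simp
  from real_of_twisted_span[OF this]
  have I: "(odd d \<longrightarrow> I \<in> qspan (S_o (sum_list ks) d)) \<and> (even d \<longrightarrow> I \<in> qspan (S_e (sum_list ks) d))"
    unfolding ed .
  have "(-1) ^ length ks \<in> (\<rat> :: real set)" by simp
  thus ?thesis unfolding Ls using I qspan_scale by blast
qed

end
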